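(* Let $(S,U,A,C)$ be an instance of WSP with $n=|U|$, $k=|S|$, $m=|C|$. Let $u_1,\dots,u_n$ be an ordering of $U$, let $\approx$ be a plan-indistinguishability relation with respect to $C$ that has width $w$ with respect to $u_1,\dots,u_n$, and suppose there exists an encoding for $\approx$. Then $(S,U,A,C)$ can be solved in time $O^*(3^k w\log w)$.
   Context: An instance of WSP is a tuple $(S,U,A,C)$: $S$ a finite set of tasks, $U$ a finite set of users, $A(s)\subseteq U$ the authorization list of $s\in S$, $C$ a set of constraints; a constraint is a pair $(L,\Theta)$ with $L\subseteq S$ and $\Theta$ a set of functions $L\to U$. A plan is a function $\pi:T\to X$ with $T\subseteq S$, $X\subseteq U$, where $\mathrm{task}(\pi)=T$ and $\mathrm{user}(\pi)=X$ are part of the data of $\pi$ (so $X$ may contain users to which no task is assigned). $\pi$ satisfies $(L,\Theta)$ if $L\setminus T\neq\emptyset$ or $\pi|_L\in\Theta$; it is eligible if it satisfies all constraints in $C$, authorized if $\pi(s)\in A(s)$ for all $s\in T$, valid if authorized and eligible, complete if it is a plan $S\to U$. Solving WSP means outputting a valid complete plan if one exists and reporting that none exists otherwise. It is assumed each constraint and authorization can be checked in time polynomial in $n,k,m$; $O^*(h)$ means $O(q(n,k,m)h)$ for a polynomial $q$. Plans are disjoint if their task sets are disjoint and their user sets are disjoint; the union $\pi_1\cup\pi_2$ of disjoint plans has the union task and user sets and agrees with each $\pi_i$ on $\mathrm{task}(\pi_i)$. Eligible plans $\pi_1,\pi_2$ are extension-equivalent if they have the same user set and task set and for every plan $\pi'$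 disjoint from both, $\pi_1\cup\pi'$ is eligible iff $\pi_2\cup\pi'$ is. A plan-indistinguishability relation with respect to $C$ is an equivalence relation $\approx$ on eligible plans refining extension-equivalence such that if $\pi_1\approx\pi_2$ are eligible and $\pi'$ is disjoint from both with $\pi_1\cup\pi'$ eligible, then $\pi_1\cup\pi'\approx\pi_2\cup\pi'$. For $X\subseteq U$, $T\subseteq S$, $\Pi[X,T]$ denotes the set of eligible plans with user set $X$ and task set $T$. With $U_i=\{u_1,\dots,u_i\}$, the width of $\approx$ with respect to $u_1,\dots,u_n$ is the maximum over $i\in[n]$ and $T\subseteq S$ of the number of $\approx$-equivalence classes meeting $\Pi[U_i,T]$. An encoding for $\approx$ is a function $\mathrm{enc}$ from the set of all plans to some set $P$ such that, with $P[X,T]=\mathrm{enc}(\Pi[X,T])$, for all $X,T$ and $\pi_1,\pi_2\in\Pi[X,T]$: (1) $\mathrm{enc}(\pi_1)=\mathrm{enc}(\pi_2)$ iff $\pi_1\approx\pi_2$; (2) $\mathrm{enc}(\pi_1)$ is computable in time polynomial in $n,k,m$; (3) there is a linear order on $P[X,T]$ whose comparisons are decidable in time polynomial in $n,k,m$.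
   Formalization: In the time bound w log w is read with max(2,w) in place of w, since for w ≤ 1 the literal bound would be 0 (for example with no constraints and width 1); the width is taken to be 0 when there are no users. *)

theory Defs
  imports Complex_Main
begin

section \<open>The workflow satisfiability problem\<close>

type_synonym ('s, 'u) wsp_constraint = "'s set \<times> ('s \<rightharpoonup> 'u) set"

text \<open>A plan is stored as its user set (which may contain users without a task) and a partial
  map whose domain is its task set.\<close>

type_synonym ('s, 'u) plan = "'u set \<times> ('s \<rightharpoonup> 'u)"

abbreviation users :: "('s, 'u) plan \<Rightarrow> 'u set" where
  "users \<pi> \<equiv> fst \<pi>"

abbreviation tasks :: "('s, 'u) plan \<Rightarrow> 's set" where
  "tasks \<pi> \<equiv> dom (snd \<pi>)"

definition wsp_instance ::
  "'s set \<Rightarrow> 'u set \<Rightarrow> ('s \<Rightarrow> 'u set) \<Rightarrow> ('s, 'u) wsp_constraint set \<Rightarrow> bool" where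
  "wsp_instance S U A C \<longleftrightarrow>
     finite S \<and> finite U \<and> (\<forall>s\<in>S. A s \<subseteq> U) \<and>
     (\<forall>(L, \<Theta>)\<in>C. L \<subseteq> S \<and> (\<forall>\<theta>\<in>\<Theta>. dom \<theta> = L \<and> ran \<theta> \<subseteq> U))"

definition is_plan :: "'s set \<Rightarrow> 'u set \<Rightarrow> ('s, 'u) plan \<Rightarrow> bool" where
  "is_plan S U \<pi> \<longleftrightarrow> tasks \<pi> \<subseteq> S \<and> users \<pi> \<subseteq> U \<and> ran (snd \<pi>) \<subseteq> users \<pi>"

definition satisfies :: "('s, 'u) plan \<Rightarrow> ('s, 'u) wsp_constraint \<Rightarrow> bool" where
  "satisfies \<pi> c \<longleftrightarrow> fst c - tasks \<pi> \<noteq> {} \<or> snd \<pi> |` fst c \<in> snd c"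

definition eligible ::
  "'s set \<Rightarrow> 'u set \<Rightarrow> ('s, 'u) wsp_constraint set \<Rightarrow> ('s, 'u) plan \<Rightarrow> bool" where
  "eligible S U C \<pi> \<longleftrightarrow> is_plan S U \<pi> \<and> (\<forall>c\<in>C. satisfies \<pi> c)"

definition authorized :: "('s \<Rightarrow> 'u set) \<Rightarrow> ('s, 'u) plan \<Rightarrow> bool" where
  "authorized A \<pi> \<longleftrightarrow> (\<forall>s\<in>tasks \<pi>. the (snd \<pi> s) \<in> A s)"

definition valid ::
  "'s set \<Rightarrow> 'u set \<Rightarrow> ('s \<Rightarrow> 'u set) \<Rightarrow> ('s, 'u) wsp_constraint set \<Rightarrow> ('s, 'u) plan \<Rightarrow> bool" where
  "valid S U A C \<pi> \<longleftrightarrow> authorized A \<pi> \<and> eligible S U C \<pi>"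

definition complete_plan :: "'s set \<Rightarrow> 'u set \<Rightarrow> ('s, 'u) plan \<Rightarrow> bool" where
  "complete_plan S U \<pi> \<longleftrightarrow> is_plan S U \<pi> \<and> tasks \<pi> = S \<and> users \<pi> = U"

definition disjoint_plans :: "('s, 'u) plan \<Rightarrow> ('s, 'u) plan \<Rightarrow> bool" where
  "disjoint_plans \<pi>\<^sub>1 \<pi>\<^sub>2 \<longleftrightarrow> tasks \<pi>\<^sub>1 \<inter> tasks \<pi>\<^sub>2 = {} \<and> users \<pi>\<^sub>1 \<inter> users \<pi>\<^sub>2 = {}"

definition plan_union :: "('s, 'u) plan \<Rightarrow> ('s, 'u) plan \<Rightarrow> ('s, 'u) plan" where
  "plan_union \<pi>\<^sub>1 \<pi>\<^sub>2 = (users \<pi>\<^sub>1 \<union> users \<pi>\<^sub>2, snd \<pi>\<^sub>1 ++ snd \<pi>\<^sub>2)"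

definition ext_equiv ::
  "'s set \<Rightarrow> 'u set \<Rightarrow> ('s, 'u) wsp_constraint set \<Rightarrow> (('s, 'u) plan \<times> ('s, 'u) plan) set" where
  "ext_equiv S U C =
     {(\<pi>\<^sub>1, \<pi>\<^sub>2). eligible S U C \<pi>\<^sub>1 \<and> eligible S U C \<pi>\<^sub>2 \<and>
        users \<pi>\<^sub>1 = users \<pi>\<^sub>2 \<and> tasks \<pi>\<^sub>1 = tasks \<pi>\<^sub>2 \<and>
        (\<forall>\<pi>'. is_plan S U \<pi>' \<and> disjoint_plans \<pi>\<^sub>1 \<pi>' \<and> disjoint_plans \<pi>\<^sub>2 \<pi>' \<longrightarrow>
           (eligible S U C (plan_union \<pi>\<^sub>1 \<pi>') \<longleftrightarrow> eligible S U C (plan_union \<pi>\<^sub>2 \<pi>')))}"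

definition plan_indistinguishability ::
  "'s set \<Rightarrow> 'u set \<Rightarrow> ('s, 'u) wsp_constraint set \<Rightarrow>
   (('s, 'u) plan \<times> ('s, 'u) plan) set \<Rightarrow> bool" where
  "plan_indistinguishability S U C R \<longleftrightarrow>
     equiv {\<pi>. eligible S U C \<pi>} R \<and> R \<subseteq> ext_equiv S U C \<and>
     (\<forall>\<pi>\<^sub>1 \<pi>\<^sub>2 \<pi>'. (\<pi>\<^sub>1, \<pi>\<^sub>2) \<in> R \<and> is_plan S U \<pi>' \<and>
        disjoint_plans \<pi>\<^sub>1 \<pi>' \<and> disjoint_plans \<pi>\<^sub>2 \<pi>' \<and> eligible S U C (plan_union \<pi>\<^sub>1 \<pi>') \<longrightarrow>
        (plan_union \<pi>\<^sub>1 \<pi>', plan_union \<pi>\<^sub>2 \<pi>') \<in> R)"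

definition eligible_plans ::
  "'s set \<Rightarrow> 'u set \<Rightarrow> ('s, 'u) wsp_constraint set \<Rightarrow> 'u set \<Rightarrow> 's set \<Rightarrow> ('s, 'u) plan set" where
  "eligible_plans S U C X T = {\<pi>. eligible S U C \<pi> \<and> users \<pi> = X \<and> tasks \<pi> = T}"

text \<open>The inserted 0 only matters when there are no users: then the maximum ranges over the empty
  set.\<close>

definition width ::
  "'s set \<Rightarrow> 'u list \<Rightarrow> ('s, 'u) wsp_constraint set \<Rightarrow>
   (('s, 'u) plan \<times> ('s, 'u) plan) set \<Rightarrow> nat" where
  "width S us C R = Max (insert 0
     {card {c \<in> {\<pi>. eligible S (set us) C \<pi>} // R.
              c \<inter> eligible_plans S (set us) C (set (take i us)) T \<noteq> {}} | i T.
        i \<in> {1..length us} \<and> T \<subseteq> S})"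

definition enumerates :: "'a list \<Rightarrow> 'a set \<Rightarrow> bool" where
  "enumerates xs X \<longleftrightarrow> distinct xs \<and> set xs = X"


section \<open>Model of computation\<close>

text \<open>Programs are written in a strict first-order functional language over binary trees (in the
  style of Jones's language F). Trees are immutable and shared, so every evaluation step is a
  constant number of pointer operations, and the running time is the number of steps.
  A program is a list of function bodies; each function has one argument, \<open>Var i\<close> refers to the
  \<open>i\<close>-th innermost bound value, and \<open>Call f\<close> calls the \<open>f\<close>-th function.\<close>

datatype tree = Leaf | Node tree tree

datatype expr =
    Var nat
  | Empty
  | Pair expr expr
  | Left expr
  | Right expr
  | Cond expr expr expr
  | Bind expr expr
  | Call nat expr

type_synonym program = "expr list"

fun left :: "tree \<Rightarrow> tree" where
  "left Leaf = Leaf"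
| "left (Node a b) = a"

fun right :: "tree \<Rightarrow> tree" where
  "right Leaf = Leaf"
| "right (Node a b) = b"

inductive eval :: "program \<Rightarrow> tree list \<Rightarrow> expr \<Rightarrow> tree \<Rightarrow> nat \<Rightarrow> bool" for P where
  Var: "i < length \<rho> \<Longrightarrow> eval P \<rho> (Var i) (\<rho> ! i) 1"
| Empty: "eval P \<rho> Empty Leaf 1"
| Pair: "eval P \<rho> a v s \<Longrightarrow> eval P \<rho> b w t \<Longrightarrow> eval P \<rho> (Pair a b) (Node v w) (s + t + 1)"
| Left: "eval P \<rho> a v t \<Longrightarrow> eval P \<rho> (Left a) (left v) (t + 1)"
| Right: "eval P \<rho> a v t \<Longrightarrow> eval P \<rho> (Right a) (right v) (t + 1)"
| Cond_Node: "eval P \<rho> c (Node x y) s \<Longrightarrow> eval P \<rho> a v t \<Longrightarrow> eval P \<rho> (Cond c a b) v (s + t + 1)"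
| Cond_Leaf: "eval P \<rho> c Leaf s \<Longrightarrow> eval P \<rho> b v t \<Longrightarrow> eval P \<rho> (Cond c a b) v (s + t + 1)"
| Bind: "eval P \<rho> a v s \<Longrightarrow> eval P (v # \<rho>) b w t \<Longrightarrow> eval P \<rho> (Bind a b) w (s + t + 1)"
| Call: "eval P \<rho> a v s \<Longrightarrow> f < length P \<Longrightarrow> eval P [v] (P ! f) w t \<Longrightarrow>
    eval P \<rho> (Call f a) w (s + t + 1)"

lemma eval_deterministic:
  "eval P \<rho> e v t \<Longrightarrow> eval P \<rho> e v' t' \<Longrightarrow> v' = v \<and> t' = t"
proof (induction arbitrary: v' t' rule: eval.induct)
  case (Var i \<rho>)
  then show ?case by (auto elim: eval.cases)
next
  case (Empty \<rho>)
  then show ?case by (auto elim: eval.cases)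
next
  case (Pair \<rho> a v s b w t)
  from Pair.prems show ?case by cases (auto dest: Pair.IH)
next
  case (Left \<rho> a v t)
  from Left.prems show ?case by cases (auto dest: Left.IH)
next
  case (Right \<rho> a v t)
  from Right.prems show ?case by cases (auto dest: Right.IH)
next
  case (Cond_Node \<rho> c x y s a v t b)
  from Cond_Node.prems show ?case by cases (auto dest: Cond_Node.IH)
next
  case (Cond_Leaf \<rho> c s b v t a)
  from Cond_Leaf.prems show ?case by cases (auto dest: Cond_Leaf.IH)
next
  case (Bind \<rho> a v s b w t)
  from Bind.prems show ?case by cases (use Bind.IH in blast)
next
  case (Call \<rho> a v s f w t)
  from Call.prems show ?case by cases (use Call.IH in blast)
qed

definition runs :: "program \<Rightarrow> nat \<Rightarrow> tree \<Rightarrow> tree \<Rightarrow> nat \<Rightarrow> bool" where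
  "runs P f x v t \<longleftrightarrow> f < length P \<and> eval P [x] (P ! f) v t"

definition computes_within :: "program \<Rightarrow> nat \<Rightarrow> tree \<Rightarrow> tree \<Rightarrow> nat \<Rightarrow> bool" where
  "computes_within P f x v B \<longleftrightarrow> (\<exists>t\<le>B. runs P f x v t)"

text \<open>Polynomials in three variables with natural number coefficients.\<close>

inductive polynomial3 :: "(nat \<Rightarrow> nat \<Rightarrow> nat \<Rightarrow> nat) \<Rightarrow> bool" where
  "polynomial3 (\<lambda>n k m. c)"
| "polynomial3 (\<lambda>n k m. n)"
| "polynomial3 (\<lambda>n k m. k)"
| "polynomial3 (\<lambda>n k m. m)"
| "polynomial3 p \<Longrightarrow> polynomial3 q \<Longrightarrow> polynomial3 (\<lambda>n k m. p n k m + q n k m)"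
| "polynomial3 p \<Longrightarrow> polynomial3 q \<Longrightarrow> polynomial3 (\<lambda>n k m. p n k m * q n k m)"


section \<open>Representation of instances and plans as trees\<close>

fun list_tree :: "tree list \<Rightarrow> tree" where
  "list_tree [] = Leaf"
| "list_tree (x # xs) = Node x (list_tree xs)"

definition num_tree :: "nat \<Rightarrow> tree" where
  "num_tree i = list_tree (replicate i Leaf)"

definition bool_tree :: "bool \<Rightarrow> tree" where
  "bool_tree b = (if b then Node Leaf Leaf else Leaf)"

definition set_tree :: "'a list \<Rightarrow> 'a set \<Rightarrow> tree" where
  "set_tree xs X = list_tree (map (\<lambda>x. bool_tree (x \<in> X)) xs)"

text \<open>Tasks, users and constraints are named by their positions in the enumerations \<open>ss\<close>, \<open>us\<close>
  and \<open>cs\<close>. A plan is represented by its user set and the table of its values along \<open>ss\<close>.\<close>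

definition user_tree :: "'u list \<Rightarrow> 'u \<Rightarrow> tree" where
  "user_tree us u = num_tree (LEAST j. j < length us \<and> us ! j = u)"

definition plan_tree :: "'s list \<Rightarrow> 'u list \<Rightarrow> ('s, 'u) plan \<Rightarrow> tree" where
  "plan_tree ss us \<pi> = Node (set_tree us (users \<pi>))
     (list_tree (map (\<lambda>s. case snd \<pi> s of None \<Rightarrow> Leaf | Some u \<Rightarrow> Node Leaf (user_tree us u)) ss))"

text \<open>The tree \<open>D\<close> is a description of the instance, in any format: it is only accessed through the
  procedures \<open>fa\<close> (authorization check), \<open>fc\<close> (constraint check), \<open>fe\<close> (encoding) and \<open>fo\<close>
  (comparison of codes) of the program \<open>P\<close>, and \<open>B\<close> bounds the running time of each such call.\<close>

definition checkable_within ::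
  "program \<Rightarrow> nat \<Rightarrow> nat \<Rightarrow> nat \<Rightarrow> tree \<Rightarrow> 's list \<Rightarrow> 'u list \<Rightarrow> ('s, 'u) wsp_constraint list \<Rightarrow>
   ('s \<Rightarrow> 'u set) \<Rightarrow> bool" where
  "checkable_within P fa fc B D ss us cs A \<longleftrightarrow>
     (\<forall>i<length ss. \<forall>j<length us.
        computes_within P fa (Node D (Node (num_tree i) (num_tree j)))
          (bool_tree (us ! j \<in> A (ss ! i))) B) \<and>
     (\<forall>j<length cs. \<forall>\<pi>. is_plan (set ss) (set us) \<pi> \<longrightarrow>
        computes_within P fc (Node D (Node (num_tree j) (plan_tree ss us \<pi>)))
          (bool_tree (satisfies \<pi> (cs ! j))) B)"

text \<open>Codes are trees, since they are results of computations. The linear order on the codes of the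
  plans with user set \<open>X\<close> and task set \<open>T\<close> may depend on \<open>X\<close> and \<open>T\<close>, so these are passed to the
  comparison procedure.\<close>

definition encoding_within ::
  "program \<Rightarrow> nat \<Rightarrow> nat \<Rightarrow> nat \<Rightarrow> tree \<Rightarrow> 's list \<Rightarrow> 'u list \<Rightarrow> ('s, 'u) wsp_constraint set \<Rightarrow>
   (('s, 'u) plan \<times> ('s, 'u) plan) set \<Rightarrow> (('s, 'u) plan \<Rightarrow> tree) \<Rightarrow> bool" where
  "encoding_within P fe fo B D ss us C R enc \<longleftrightarrow>
     (\<forall>X T. X \<subseteq> set us \<and> T \<subseteq> set ss \<longrightarrow>
        (let \<Pi> = eligible_plans (set ss) (set us) C X T in
           (\<forall>\<pi>\<^sub>1\<in>\<Pi>. \<forall>\<pi>\<^sub>2\<in>\<Pi>. enc \<pi>\<^sub>1 = enc \<pi>\<^sub>2 \<longleftrightarrow> (\<pi>\<^sub>1, \<pi>\<^sub>2) \<in> R) \<and>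
           (\<forall>\<pi>\<in>\<Pi>. computes_within P fe (Node D (plan_tree ss us \<pi>)) (enc \<pi>) B) \<and>
           (\<exists>r. linear_order_on (enc ` \<Pi>) r \<and>
              (\<forall>a\<in>enc ` \<Pi>. \<forall>b\<in>enc ` \<Pi>.
                 computes_within P fo
                   (Node D (Node (set_tree us X) (Node (set_tree ss T) (Node a b))))
                   (bool_tree ((a, b) \<in> r)) B))))"

definition instance_tree ::
  "tree \<Rightarrow> 's list \<Rightarrow> 'u list \<Rightarrow> ('s, 'u) wsp_constraint list \<Rightarrow> tree" where
  "instance_tree D ss us cs =
     Node D (Node (num_tree (length us)) (Node (num_tree (length ss)) (num_tree (length cs))))"

definition wsp_answer ::
  "'s list \<Rightarrow> 'u list \<Rightarrow> ('s \<Rightarrow> 'u set) \<Rightarrow> ('s, 'u) wsp_constraint set \<Rightarrow> tree \<Rightarrow> bool" where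
  "wsp_answer ss us A C v \<longleftrightarrow>
     (if \<exists>\<pi>. complete_plan (set ss) (set us) \<pi> \<and> valid (set ss) (set us) A C \<pi>
      then \<exists>\<pi>. complete_plan (set ss) (set us) \<pi> \<and> valid (set ss) (set us) A C \<pi> \<and>
             v = Node Leaf (plan_tree ss us \<pi>)
      else v = Leaf)"

end

theory Submission
  imports Defs "HOL-Library.List_Lexorder" "HOL-Library.Product_Lexorder" "HOL-Library.Log_Nat"
begin

text \<open>
  Process the users in the order \<open>u\<^sub>1, \<dots>, u\<^sub>n\<close>. After \<open>i\<close> users keep a table with one valid plan from
  each class of valid plans with user set \<open>U\<^sub>i\<close>. Removing the tasks of \<open>u\<^sub>i\<^sub>+\<^sub>1\<close> from a valid plan leaves
  a valid plan, and exchanging the latter for an equivalent one yields a plan equivalent to the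
  original. Hence extending the plans of the table by assigning \<open>u\<^sub>i\<^sub>+\<^sub>1\<close> to all sets of free tasks
  meets every class of the next level. For each task set \<open>T\<close> the table contains at most \<open>w\<close> plans,
  with \<open>2 ^ (k - |T|)\<close> extensions each, so a level has at most \<open>w * 3 ^ k\<close> candidates.
  Representatives are selected by a merge sort that drops elements with equal keys, where the key of
  a plan is its task set followed by the rank of its code; its recursion depth is \<open>log w + O(k)\<close>.
\<close>

section \<open>Restricting and exchanging plans\<close>

definition plan_restrict :: "('s, 'u) plan \<Rightarrow> 'u set \<Rightarrow> ('s, 'u) plan" where
  "plan_restrict \<pi> X = (users \<pi> \<inter> X, snd \<pi> |` {s. the (snd \<pi> s) \<in> X})"

lemma users_plan_restrict [simp]: "users (plan_restrict \<pi> X) = users \<pi> \<inter> X"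
  and tasks_plan_restrict: "tasks (plan_restrict \<pi> X) = {s \<in> tasks \<pi>. the (snd \<pi> s) \<in> X}"
  by (auto simp: plan_restrict_def)

lemma ran_plan_restrict: "ran (snd (plan_restrict \<pi> X)) = ran (snd \<pi>) \<inter> X"
  by (force simp: plan_restrict_def ran_def restrict_map_def split: if_splits)

lemma is_plan_restrict: "is_plan S U \<pi> \<Longrightarrow> is_plan S U (plan_restrict \<pi> X)"
  by (auto simp: is_plan_def ran_plan_restrict tasks_plan_restrict)

lemma satisfies_restrict:
  assumes "satisfies \<pi> c"
  shows "satisfies (plan_restrict \<pi> X) c"
proof (cases "fst c \<subseteq> tasks (plan_restrict \<pi> X)")
  case True
  then have "snd (plan_restrict \<pi> X) |` fst c = snd \<pi> |` fst c"
    by (auto simp: plan_restrict_def restrict_map_def fun_eq_iff)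
  moreover have "fst c \<subseteq> tasks \<pi>"
    using True by (auto simp: tasks_plan_restrict)
  ultimately show ?thesis
    using assms by (auto simp: satisfies_def)
qed (auto simp: satisfies_def)

lemma valid_restrict: "valid S U A C \<pi> \<Longrightarrow> valid S U A C (plan_restrict \<pi> X)"
  by (auto simp: valid_def eligible_def is_plan_restrict satisfies_restrict)
    (simp add: authorized_def plan_restrict_def)

lemma plan_union_restrict_Compl: "plan_union (plan_restrict \<pi> X) (plan_restrict \<pi> (- X)) = \<pi>"
  by (auto simp: plan_union_def plan_restrict_def prod_eq_iff fun_eq_iff map_add_def
      restrict_map_def split: option.split)

lemma authorized_union:
  "authorized A \<pi>\<^sub>1 \<Longrightarrow> authorized A \<pi>\<^sub>2 \<Longrightarrow> authorized A (plan_union \<pi>\<^sub>1 \<pi>\<^sub>2)"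
  by (fastforce simp: authorized_def plan_union_def map_add_def dom_def split: option.splits)

lemma indistinguishable_imp_ext_equiv:
  "plan_indistinguishability S U C R \<Longrightarrow> (\<pi>\<^sub>1, \<pi>\<^sub>2) \<in> R \<Longrightarrow> (\<pi>\<^sub>1, \<pi>\<^sub>2) \<in> ext_equiv S U C"
  by (auto simp: plan_indistinguishability_def)

lemma exchange_indistinguishable_part:
  assumes indist: "plan_indistinguishability S U C R"
    and \<pi>: "valid S U A C \<pi>"
    and \<pi>': "valid S U A C \<pi>'" "(plan_restrict \<pi> X, \<pi>') \<in> R"
  defines "\<sigma> \<equiv> plan_union \<pi>' (plan_restrict \<pi> (- X))"
  shows "valid S U A C \<sigma>" "(\<pi>, \<sigma>) \<in> R"
proof -
  let ?\<tau> = "plan_restrict \<pi> (- X)"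
  have \<tau>: "valid S U A C ?\<tau>"
    using \<pi> by (rule valid_restrict)
  have same: "users \<pi>' = users (plan_restrict \<pi> X)" "tasks \<pi>' = tasks (plan_restrict \<pi> X)"
    using indistinguishable_imp_ext_equiv[OF indist \<pi>'(2)] by (simp_all add: ext_equiv_def)
  have "disjoint_plans (plan_restrict \<pi> X) ?\<tau>" "disjoint_plans \<pi>' ?\<tau>"
    unfolding disjoint_plans_def same by (auto simp: tasks_plan_restrict)
  moreover have "is_plan S U ?\<tau>" "eligible S U C \<pi>"
    using \<tau> \<pi> by (simp_all add: valid_def eligible_def)
  ultimately have "(plan_union (plan_restrict \<pi> X) ?\<tau>, \<sigma>) \<in> R"
    using indist \<pi>'(2) unfolding plan_indistinguishability_def \<sigma>_def
    by (metis plan_union_restrict_Compl)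
  then show R: "(\<pi>, \<sigma>) \<in> R"
    by (simp add: plan_union_restrict_Compl)
  have "eligible S U C \<sigma>"
    using indistinguishable_imp_ext_equiv[OF indist R] by (simp add: ext_equiv_def)
  then show "valid S U A C \<sigma>"
    using \<pi>'(1) \<tau> by (simp add: valid_def \<sigma>_def authorized_union)
qed


section \<open>Transversals and width\<close>

definition transversal :: "('a \<times> 'a) set \<Rightarrow> 'a set \<Rightarrow> 'a set \<Rightarrow> bool" where
  "transversal R Z Y \<longleftrightarrow> Y \<subseteq> Z \<and> Z \<subseteq> R `` Y \<and> inj_on (\<lambda>y. R `` {y}) Y"

lemma finite_eligible:
  assumes "finite S" "finite U"
  shows "finite {\<pi> :: ('s, 'u) plan. eligible S U C \<pi>}"
proof (rule finite_subset)
  let ?maps = "\<Union>T\<in>Pow S. {f :: 's \<rightharpoonup> 'u. dom f = T \<and> ran f \<subseteq> U}"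
  show "{\<pi>. eligible S U C \<pi>} \<subseteq> Pow U \<times> ?maps"
    by (auto simp: eligible_def is_plan_def)
  have "finite ?maps"
    using assms by (intro finite_UN_I finite_set_of_finite_maps) (auto intro: finite_subset)
  then show "finite (Pow U \<times> ?maps)"
    by (intro finite_cartesian_product) (simp_all add: assms)
qed

lemma card_inequivalent_le_width:
  assumes fin: "finite S" and equiv: "equiv {\<pi>. eligible S (set us) C \<pi>} R"
    and iT: "i \<in> {1..length us}" "T \<subseteq> S"
    and Z: "Z \<subseteq> eligible_plans S (set us) C (set (take i us)) T"
    and inj: "inj_on (\<lambda>\<pi>. R `` {\<pi>}) Z"
  shows "card Z \<le> width S us C R"
proof -
  let ?classes = "\<lambda>i T. {c \<in> {\<pi>. eligible S (set us) C \<pi>} // R.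
    c \<inter> eligible_plans S (set us) C (set (take i us)) T \<noteq> {}}"
  have "(\<lambda>\<pi>. R `` {\<pi>}) ` Z \<subseteq> ?classes i T"
  proof clarify
    fix \<pi>
    assume "\<pi> \<in> Z"
    then have "\<pi> \<in> eligible_plans S (set us) C (set (take i us)) T" "eligible S (set us) C \<pi>"
      using Z by (auto simp: eligible_plans_def)
    then show "R `` {\<pi>} \<in> {\<pi>. eligible S (set us) C \<pi>} // R \<and>
        R `` {\<pi>} \<inter> eligible_plans S (set us) C (set (take i us)) T \<noteq> {}"
      using equiv_class_self[OF equiv, of \<pi>] quotientI[of \<pi> _ R] by blast
  qed
  moreover have "finite (?classes i T)"
    using finite_quotient[OF finite_eligible[OF fin] equiv_type[OF equiv]] by simp
  ultimately have "card Z \<le> card (?classes i T)"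
    by (rule card_inj_on_le[OF inj])
  also have "\<dots> \<le> width S us C R"
    unfolding width_def
  proof (rule Max_ge)
    have "{card (?classes i T) |i T. i \<in> {1..length us} \<and> T \<subseteq> S} \<subseteq>
        (\<lambda>(i, T). card (?classes i T)) ` ({1..length us} \<times> Pow S)"
      by auto
    then show "finite (insert 0 {card (?classes i T) |i T. i \<in> {1..length us} \<and> T \<subseteq> S})"
      using fin by (simp add: finite_subset)
  qed (use iT in auto)
  finally show ?thesis .
qed

lemma eligible_plans_no_users: "eligible_plans S U C {} T \<subseteq> {({}, Map.empty)}"
proof
  fix \<pi>
  assume "\<pi> \<in> eligible_plans S U C {} T"
  then have "users \<pi> = {}" "ran (snd \<pi>) = {}"
    by (auto simp: eligible_plans_def eligible_def is_plan_def)
  moreover from this have "snd \<pi> s = None" for s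
    by (cases "snd \<pi> s") (auto dest: ranI)
  ultimately show "\<pi> \<in> {({}, Map.empty)}"
    by (auto simp: prod_eq_iff)
qed

lemma card_inequivalent_le_max_width:
  assumes "finite S" "equiv {\<pi>. eligible S (set us) C \<pi>} R" "i \<le> length us" "T \<subseteq> S"
    and Z: "Z \<subseteq> eligible_plans S (set us) C (set (take i us)) T"
    and "inj_on (\<lambda>\<pi>. R `` {\<pi>}) Z"
  shows "card Z \<le> max 2 (width S us C R)"
proof (cases "i = 0")
  case True
  then have "Z \<subseteq> {({}, Map.empty)}"
    using Z eligible_plans_no_users by fastforce
  from card_mono[OF _ this] show ?thesis by simp
next
  case False
  then have "card Z \<le> width S us C R"
    using assms by (intro card_inequivalent_le_width[where i = i]) auto
  then show ?thesis by simp
qed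


section \<open>Extensions of a plan by one user\<close>

definition extensions :: "'u \<Rightarrow> 's list \<Rightarrow> ('s \<rightharpoonup> 'u) \<Rightarrow> ('s \<rightharpoonup> 'u) list" where
  "extensions u ss f =
     map (\<lambda>ts. override_on f (\<lambda>_. Some u) (set ts)) (subseqs (filter (\<lambda>s. f s = None) ss))"

lemma extensions_Nil [simp]: "extensions u [] f = [f]"
  by (simp add: extensions_def)

lemma extensions_Cons [simp]:
  "extensions u (s # ss) f =
     (if f s = None then map (\<lambda>g. g(s \<mapsto> u)) (extensions u ss f) @ extensions u ss f
      else extensions u ss f)"
  by (simp add: extensions_def Let_def override_on_insert comp_def)

lemma set_extensions:
  "set (extensions u ss f) = override_on f (\<lambda>_. Some u) ` Pow (set ss - dom f)"
proof -
  have "set (extensions u ss f) =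
      override_on f (\<lambda>_. Some u) ` set ` set (subseqs (filter (\<lambda>s. f s = None) ss))"
    by (auto simp: extensions_def)
  also have "set (filter (\<lambda>s. f s = None) ss) = set ss - dom f"
    by auto
  then have "set ` set (subseqs (filter (\<lambda>s. f s = None) ss)) = Pow (set ss - dom f)"
    by (simp only: subseqs_powset)
  finally show ?thesis .
qed

lemma extensions_apply_notin: "g \<in> set (extensions u ss f) \<Longrightarrow> s \<notin> set ss \<Longrightarrow> g s = f s"
  by (auto simp: set_extensions override_on_def)

lemma length_extensions:
  assumes "distinct ss"
  shows "length (extensions u ss f) = 2 ^ card (set ss - dom f)"
proof -
  have "set ss - dom f = set (filter (\<lambda>s. f s = None) ss)"
    by auto
  then show ?thesis
    using assms distinct_card[OF distinct_filter, of ss "\<lambda>s. f s = None"]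
    by (simp add: extensions_def length_subseqs del: set_filter)
qed

lemma length_extensions_pos: "0 < length (extensions u ss f)"
  by (simp add: extensions_def length_subseqs)

lemma is_plan_extension:
  assumes "is_plan S U (X, f)" "set ss \<subseteq> S" "u \<in> U" "g \<in> set (extensions u ss f)"
  shows "is_plan S U (insert u X, g)"
proof -
  obtain T where T: "T \<subseteq> set ss" "g = override_on f (\<lambda>_. Some u) T"
    using assms(4) by (auto simp: set_extensions)
  then have "dom g \<subseteq> dom f \<union> T" "ran g \<subseteq> insert u (ran f)"
    by (auto simp: ran_def override_on_def split: if_splits)
  then show ?thesis
    using assms(1-3) T(1) unfolding is_plan_def fst_conv snd_conv by blast
qed

lemma map_add_mem_extensions:
  assumes "dom h \<subseteq> set ss - dom f" "ran h \<subseteq> {u}"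
  shows "f ++ h \<in> set (extensions u ss f)"
proof -
  have "h s = Some u" if "s \<in> dom h" for s
    using that assms(2) by (auto simp: dom_def ran_def)
  then have "f ++ h = override_on f (\<lambda>_. Some u) (dom h)"
    by (auto simp: fun_eq_iff override_on_def map_add_dom_app_simps)
  then show ?thesis
    using assms(1) by (auto simp: set_extensions)
qed

lemma sum_Pow_power_card_Diff:
  fixes a :: "'a :: comm_semiring_1"
  assumes "finite S"
  shows "(\<Sum>T\<in>Pow S. a ^ card (S - T)) = (1 + a) ^ card S"
  using prod_add[OF assms, of "\<lambda>_. 1" "\<lambda>_. a"] by simp

lemma sum_power_card_Diff_le:
  fixes a W :: nat
  assumes "finite S" "finite Z" "f ` Z \<subseteq> Pow S"
    and fibres: "\<And>T. T \<subseteq> S \<Longrightarrow> card {z \<in> Z. f z = T} \<le> W"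
  shows "(\<Sum>z\<in>Z. a ^ card (S - f z)) \<le> W * (1 + a) ^ card S"
proof -
  have "(\<Sum>z\<in>Z. a ^ card (S - f z)) = (\<Sum>T\<in>Pow S. \<Sum>z\<in>{z \<in> Z. f z = T}. a ^ card (S - f z))"
    by (rule sum.group[symmetric]) (use assms in auto)
  also have "\<dots> = (\<Sum>T\<in>Pow S. card {z \<in> Z. f z = T} * a ^ card (S - T))"
    by simp
  also have "\<dots> \<le> (\<Sum>T\<in>Pow S. W * a ^ card (S - T))"
    using fibres by (intro sum_mono mult_le_mono1) auto
  also have "\<dots> = W * (1 + a) ^ card S"
    using sum_Pow_power_card_Diff[OF assms(1), of a] by (simp flip: sum_distrib_left)
  finally show ?thesis .
qed


section \<open>Merge sort keeping one element for each key\<close>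

fun merge_key :: "('a \<Rightarrow> 'k :: linorder) \<Rightarrow> 'a list \<Rightarrow> 'a list \<Rightarrow> 'a list" where
  "merge_key key [] ys = ys"
| "merge_key key xs [] = xs"
| "merge_key key (x # xs) (y # ys) =
     (if key x \<le> key y
      then if key y \<le> key x then merge_key key xs (y # ys) else x # merge_key key xs (y # ys)
      else y # merge_key key (x # xs) ys)"

fun every_other :: "'a list \<Rightarrow> 'a list" where
  "every_other [] = []"
| "every_other (x # xs) = x # every_other (tl xs)"

lemma length_every_other: "length (every_other xs) = (length xs + 1) div 2"
  by (induction xs rule: every_other.induct) auto

lemma map_every_other: "every_other (map f xs) = map f (every_other xs)"
  by (induction xs rule: every_other.induct) (simp_all flip: map_tl)

lemma length_every_other_tl:
  "length (every_other xs) + length (every_other (tl xs)) = length xs"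
proof (induction xs rule: every_other.induct)
  case (2 x xs)
  then show ?case by (cases xs) auto
qed simp

lemma set_every_other: "set (every_other xs) \<union> set (every_other (tl xs)) = set xs"
proof (induction xs rule: every_other.induct)
  case (2 x xs)
  then show ?case by (cases xs) auto
qed simp

function msort_key :: "('a \<Rightarrow> 'k :: linorder) \<Rightarrow> 'a list \<Rightarrow> 'a list" where
  "msort_key key xs =
     (if tl xs = [] then xs
      else merge_key key (msort_key key (every_other xs)) (msort_key key (every_other (tl xs))))"
  by auto
termination
proof (relation "measure (length \<circ> snd)")
  fix key :: "'a \<Rightarrow> 'k" and xs :: "'a list"
  assume "tl xs \<noteq> []"
  then show "((key, every_other xs), (key, xs)) \<in> measure (length \<circ> snd)"
    and "((key, every_other (tl xs)), (key, xs)) \<in> measure (length \<circ> snd)"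
    by (auto simp: length_every_other simp flip: length_greater_0_conv)
qed simp

declare msort_key.simps [simp del]

lemma msort_key_short: "tl xs = [] \<Longrightarrow> msort_key key xs = xs"
  and msort_key_split: "tl xs \<noteq> [] \<Longrightarrow> msort_key key xs =
    merge_key key (msort_key key (every_other xs)) (msort_key key (every_other (tl xs)))"
  by (simp_all add: msort_key.simps[of key xs])

lemma length_merge_key: "length (merge_key key xs ys) \<le> length xs + length ys"
  by (induction key xs ys rule: merge_key.induct) auto

lemma set_merge_key: "set (merge_key key xs ys) \<subseteq> set xs \<union> set ys"
  by (induction key xs ys rule: merge_key.induct) auto

lemma image_key_merge_key: "key ` set (merge_key key xs ys) = key ` (set xs \<union> set ys)"
  by (induction key xs ys rule: merge_key.induct) auto

lemma strict_sorted_merge_key: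
  "sorted_wrt (<) (map key xs) \<Longrightarrow> sorted_wrt (<) (map key ys) \<Longrightarrow>
     sorted_wrt (<) (map key (merge_key key xs ys))"
proof (induction key xs ys rule: merge_key.induct)
  case (3 key x xs y ys)
  have image: "key ` set (merge_key key zs zs') = key ` set zs \<union> key ` set zs'" for zs zs'
    by (simp add: image_key_merge_key image_Un)
  show ?case
    using 3 by (auto simp: image dest: less_trans)
qed auto

lemma length_msort_key: "length (msort_key key xs) \<le> length xs"
proof (induction key xs rule: msort_key.induct)
  case (1 key xs)
  show ?case
  proof (cases "tl xs = []")
    case False
    have "length (msort_key key xs) \<le>
        length (msort_key key (every_other xs)) + length (msort_key key (every_other (tl xs)))"
      unfolding msort_key_split[OF False] by (rule length_merge_key)
    also have "\<dots> \<le> length (every_other xs) + length (every_other (tl xs))"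
      using 1[OF False] by (rule add_mono)
    finally show ?thesis
      by (simp only: length_every_other_tl)
  qed (simp add: msort_key_short)
qed

lemma set_msort_key: "set (msort_key key xs) \<subseteq> set xs"
proof (induction key xs rule: msort_key.induct)
  case (1 key xs)
  show ?case
  proof (cases "tl xs = []")
    case False
    have "set (msort_key key xs) \<subseteq>
        set (msort_key key (every_other xs)) \<union> set (msort_key key (every_other (tl xs)))"
      unfolding msort_key_split[OF False] by (rule set_merge_key)
    also have "\<dots> \<subseteq> set (every_other xs) \<union> set (every_other (tl xs))"
      using 1[OF False] by (rule Un_mono)
    finally show ?thesis
      by (simp only: set_every_other)
  qed (simp add: msort_key_short)
qed

lemma image_key_msort_key: "key ` set (msort_key key xs) = key ` set xs"
proof (induction key xs rule: msort_key.induct)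
  case (1 key xs)
  show ?case
  proof (cases "tl xs = []")
    case False
    have "key ` set (msort_key key xs) = key ` (set (every_other xs) \<union> set (every_other (tl xs)))"
      unfolding msort_key_split[OF False] image_key_merge_key image_Un 1[OF False] ..
    then show ?thesis
      by (simp only: set_every_other)
  qed (simp add: msort_key_short)
qed

lemma strict_sorted_msort_key: "sorted_wrt (<) (map key (msort_key key xs))"
proof (induction key xs rule: msort_key.induct)
  case (1 key xs)
  show ?case
  proof (cases "tl xs = []")
    case True
    then show ?thesis
      by (cases xs) (simp_all add: msort_key_short)
  next
    case False
    then show ?thesis
      unfolding msort_key_split[OF False] by (intro strict_sorted_merge_key 1)
  qed
qed

lemma distinct_msort_key: "distinct (msort_key key xs)"
  and inj_on_key_msort_key: "inj_on key (set (msort_key key xs))"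
  using strict_sorted_msort_key[of key xs] by (simp_all add: strict_sorted_iff distinct_map)

lemma transversal_msort_key:
  assumes equiv: "equiv E R" and xs: "set xs \<subseteq> Z" "Z \<subseteq> R `` set xs"
    and key: "\<And>x y. x \<in> Z \<Longrightarrow> y \<in> Z \<Longrightarrow> key x = key y \<longleftrightarrow> (x, y) \<in> R"
  shows "transversal R Z (set (msort_key key xs))"
  unfolding transversal_def
proof (intro conjI)
  let ?ys = "msort_key key xs"
  show sub: "set ?ys \<subseteq> Z"
    using set_msort_key xs(1) by (rule order_trans)
  show "Z \<subseteq> R `` set ?ys"
  proof
    fix z
    assume "z \<in> Z"
    then obtain x where x: "x \<in> set xs" "(x, z) \<in> R"
      using xs(2) by blast
    from x(1) have "key x \<in> key ` set ?ys"
      by (simp add: image_key_msort_key)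
    then obtain y where y: "y \<in> set ?ys" "key y = key x"
      by force
    then have "(y, x) \<in> R"
      using x(1) xs(1) sub key by blast
    then show "z \<in> R `` set ?ys"
      using x(2) y(1) equiv by (meson ImageI equiv_def transD)
  qed
  show "inj_on (\<lambda>y. R `` {y}) (set ?ys)"
  proof (rule inj_onI)
    fix x y
    assume xy: "x \<in> set ?ys" "y \<in> set ?ys" and R: "R `` {x} = R `` {y}"
    have "(y, y) \<in> R"
      using xy(2) sub key by blast
    with R have "key x = key y"
      using xy sub key by blast
    with inj_on_key_msort_key show "x = y"
      using xy by (rule inj_onD)
  qed
qed


section \<open>Correctness of the dynamic program\<close>

locale wsp =
  fixes ss :: "'s list" and us :: "'u list" and cs :: "('s, 'u) wsp_constraint list"
    and A :: "'s \<Rightarrow> 'u set" and R :: "(('s, 'u) plan \<times> ('s, 'u) plan) set"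
  assumes distinct_ss: "distinct ss" and distinct_us: "distinct us"
    and indist: "plan_indistinguishability (set ss) (set us) (set cs) R"
begin

abbreviation "eligible_plan \<equiv> eligible (set ss) (set us) (set cs)"
abbreviation "valid_plan \<equiv> valid (set ss) (set us) A (set cs)"
abbreviation "\<Pi> \<equiv> eligible_plans (set ss) (set us) (set cs)"
abbreviation "U i \<equiv> set (take i us)"
abbreviation "table_size \<equiv> max 2 (width (set ss) us (set cs) R) * 3 ^ length ss"

definition valid_plans :: "'u set \<Rightarrow> ('s, 'u) plan set" where
  "valid_plans X = {\<pi>. valid_plan \<pi> \<and> users \<pi> = X}"

definition candidates :: "'u set \<Rightarrow> 'u \<Rightarrow> ('s, 'u) plan list \<Rightarrow> ('s, 'u) plan list" where
  "candidates X u \<pi>s =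
     concat (map (\<lambda>\<pi>. filter valid_plan (map (\<lambda>g. (X, g)) (extensions u ss (snd \<pi>)))) \<pi>s)"

definition count_extensions :: "('s, 'u) plan list \<Rightarrow> nat" where
  "count_extensions \<pi>s = (\<Sum>\<pi>\<leftarrow>\<pi>s. 2 ^ card (set ss - tasks \<pi>))"

lemma equiv_R: "equiv {\<pi>. eligible_plan \<pi>} R"
  using indist by (simp add: plan_indistinguishability_def)

lemma U_Suc: "i < length us \<Longrightarrow> U (Suc i) = insert (us ! i) (U i)"
  by (simp add: take_Suc_conv_app_nth)

lemma nth_notin_U: "i < length us \<Longrightarrow> us ! i \<notin> U i"
  using distinct_us by (auto simp: in_set_conv_nth nth_eq_iff_index_eq)

lemma set_candidates: "set (candidates X u \<pi>s) \<subseteq> valid_plans X"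
  by (auto simp: candidates_def valid_plans_def)

lemma mem_candidates_iff:
  "(X, g) \<in> set (candidates X u \<pi>s) \<longleftrightarrow>
     valid_plan (X, g) \<and> (\<exists>\<pi>\<in>set \<pi>s. g \<in> set (extensions u ss (snd \<pi>)))"
  by (auto simp: candidates_def)

lemma candidates_cover:
  assumes \<pi>s: "transversal R (valid_plans X) (set \<pi>s)" and u: "u \<notin> X"
  shows "valid_plans (insert u X) \<subseteq> R `` set (candidates (insert u X) u \<pi>s)"
proof
  fix \<pi>
  assume "\<pi> \<in> valid_plans (insert u X)"
  then have \<pi>: "valid_plan \<pi>" "users \<pi> = insert u X"
    by (simp_all add: valid_plans_def)
  let ?\<tau> = "plan_restrict \<pi> (- X)"
  have "plan_restrict \<pi> X \<in> valid_plans X"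
    using \<pi> by (auto simp: valid_plans_def valid_restrict)
  then obtain \<pi>' where \<pi>': "\<pi>' \<in> set \<pi>s" "(plan_restrict \<pi> X, \<pi>') \<in> R"
    using \<pi>s equiv_R unfolding transversal_def by (meson ImageE equiv_def subsetD symD)
  then have valid': "valid_plan \<pi>'" and users': "users \<pi>' = X"
    using \<pi>s by (auto simp: transversal_def valid_plans_def)
  note exchange = exchange_indistinguishable_part[OF indist \<pi>(1) valid' \<pi>'(2)]
  have "tasks \<pi>' = tasks (plan_restrict \<pi> X)"
    using indistinguishable_imp_ext_equiv[OF indist \<pi>'(2)] by (simp add: ext_equiv_def)
  moreover have "is_plan (set ss) (set us) \<pi>"
    using \<pi>(1) by (simp add: valid_def eligible_def)
  ultimately have "tasks ?\<tau> \<subseteq> set ss - tasks \<pi>'" "ran (snd ?\<tau>) \<subseteq> {u}"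
    using \<pi>(2) by (auto simp: is_plan_def tasks_plan_restrict ran_plan_restrict)
  then have "snd (plan_union \<pi>' ?\<tau>) \<in> set (extensions u ss (snd \<pi>'))"
    by (simp add: plan_union_def map_add_mem_extensions)
  moreover have "plan_union \<pi>' ?\<tau> = (insert u X, snd (plan_union \<pi>' ?\<tau>))"
    using \<pi>(2) users' u by (auto simp: plan_union_def)
  ultimately have "plan_union \<pi>' ?\<tau> \<in> set (candidates (insert u X) u \<pi>s)"
    using \<pi>'(1) exchange(1) mem_candidates_iff by metis
  then show "\<pi> \<in> R `` set (candidates (insert u X) u \<pi>s)"
    using exchange(2) equiv_R by (meson ImageI equiv_def symD)
qed

lemma count_extensions_transversal_le:
  assumes "i \<le> length us" "distinct \<pi>s" and \<pi>s: "transversal R (valid_plans (U i)) (set \<pi>s)"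
  shows "count_extensions \<pi>s \<le> table_size"
proof -
  have eligible: "\<pi> \<in> \<Pi> (U i) (tasks \<pi>)"
    if "\<pi> \<in> set \<pi>s" for \<pi>
    using \<pi>s that by (auto simp: transversal_def valid_plans_def valid_def eligible_plans_def)
  have "count_extensions \<pi>s = (\<Sum>\<pi>\<in>set \<pi>s. 2 ^ card (set ss - tasks \<pi>))"
    unfolding count_extensions_def using assms(2) by (rule sum_list_distinct_conv_sum_set)
  also have "\<dots> \<le> max 2 (width (set ss) us (set cs) R) * (1 + 2) ^ card (set ss)"
  proof (rule sum_power_card_Diff_le)
    show "(\<lambda>\<pi>. tasks \<pi>) ` set \<pi>s \<subseteq> Pow (set ss)"
      using eligible unfolding eligible_plans_def eligible_def is_plan_def by blast
    fix T
    assume T: "T \<subseteq> set ss"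
    have "{\<pi> \<in> set \<pi>s. tasks \<pi> = T} \<subseteq> \<Pi> (U i) T"
      using eligible by blast
    moreover have "inj_on (\<lambda>\<pi>. R `` {\<pi>}) {\<pi> \<in> set \<pi>s. tasks \<pi> = T}"
      using \<pi>s by (auto simp: transversal_def intro: inj_on_subset)
    ultimately show "card {\<pi> \<in> set \<pi>s. tasks \<pi> = T} \<le> max 2 (width (set ss) us (set cs) R)"
      using equiv_R assms(1) T by (intro card_inequivalent_le_max_width) simp_all
  qed simp_all
  finally show ?thesis
    by (simp add: distinct_card[OF distinct_ss] numeral_3_eq_3)
qed

lemma length_candidates_le: "length (candidates X u \<pi>s) \<le> count_extensions \<pi>s"
proof (induction \<pi>s)
  case (Cons \<pi> \<pi>s)
  have "length (filter valid_plan (map (\<lambda>g. (X, g)) (extensions u ss (snd \<pi>)))) \<le>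
      2 ^ card (set ss - tasks \<pi>)"
    by (rule order_trans[OF length_filter_le]) (simp add: length_extensions distinct_ss)
  with Cons show ?case
    by (simp add: candidates_def count_extensions_def)
qed (simp add: candidates_def)

lemma length_le_count_extensions: "length \<pi>s \<le> count_extensions \<pi>s"
proof -
  have "length \<pi>s = (\<Sum>\<pi>\<leftarrow>\<pi>s. 1)"
    by (simp add: sum_list_triv)
  also have "\<dots> \<le> count_extensions \<pi>s"
    unfolding count_extensions_def by (intro sum_list_mono) simp
  finally show ?thesis .
qed

lemma wsp_answer_find:
  assumes \<pi>s: "transversal R (valid_plans (set us)) (set \<pi>s)"
  shows "wsp_answer ss us A (set cs) (case find (\<lambda>\<pi>. set ss \<subseteq> tasks \<pi>) \<pi>s of
      None \<Rightarrow> Leaf | Some \<pi> \<Rightarrow> Node Leaf (plan_tree ss us \<pi>))"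
proof (cases "find (\<lambda>\<pi>. set ss \<subseteq> tasks \<pi>) \<pi>s")
  case None
  have "\<not> (complete_plan (set ss) (set us) \<pi> \<and> valid_plan \<pi>)" for \<pi>
  proof
    assume \<pi>: "complete_plan (set ss) (set us) \<pi> \<and> valid_plan \<pi>"
    then have "\<pi> \<in> R `` set \<pi>s"
      using \<pi>s by (auto simp: transversal_def valid_plans_def complete_plan_def)
    then obtain \<pi>' where \<pi>': "\<pi>' \<in> set \<pi>s" "(\<pi>', \<pi>) \<in> R"
      by blast
    then have "set ss \<subseteq> tasks \<pi>'"
      using \<pi> indistinguishable_imp_ext_equiv[OF indist \<pi>'(2)]
      by (simp add: ext_equiv_def complete_plan_def)
    with None \<pi>'(1) show False
      unfolding find_None_iff by blast
  qed
  with None show ?thesis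
    by (simp add: wsp_answer_def)
next
  case (Some \<pi>)
  then have "\<pi> \<in> set \<pi>s" "set ss \<subseteq> tasks \<pi>"
    by (auto simp: find_Some_iff)
  moreover from this have valid: "valid_plan \<pi>" and "users \<pi> = set us"
    using \<pi>s by (auto simp: transversal_def valid_plans_def)
  moreover have "is_plan (set ss) (set us) \<pi>"
    using valid by (simp add: valid_def eligible_def)
  ultimately have "complete_plan (set ss) (set us) \<pi>"
    by (simp add: complete_plan_def is_plan_def)
  with valid show ?thesis
    unfolding wsp_answer_def Some option.case by metis
qed

end

locale keyed_wsp = wsp ss us cs A R
  for ss :: "'s list" and us :: "'u list" and cs A R +
  fixes key :: "('s, 'u) plan \<Rightarrow> 'k :: linorder"
  assumes key_eq_iff: "eligible_plan \<pi>\<^sub>1 \<Longrightarrow> eligible_plan \<pi>\<^sub>2 \<Longrightarrow> users \<pi>\<^sub>1 = users \<pi>\<^sub>2 \<Longrightarrow>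
    key \<pi>\<^sub>1 = key \<pi>\<^sub>2 \<longleftrightarrow> (\<pi>\<^sub>1, \<pi>\<^sub>2) \<in> R"
begin

fun level :: "nat \<Rightarrow> ('s, 'u) plan list" where
  "level 0 = filter valid_plan [({}, Map.empty)]"
| "level (Suc i) = msort_key key (candidates (U (Suc i)) (us ! i) (level i))"

lemma distinct_level: "distinct (level i)"
  by (cases i) (simp_all add: distinct_msort_key)

lemma transversal_level: "i \<le> length us \<Longrightarrow> transversal R (valid_plans (U i)) (set (level i))"
proof (induction i)
  case 0
  have no_users: "valid_plans {} \<subseteq> {({}, Map.empty)}"
    using eligible_plans_no_users[of "set ss" "set us" "set cs"]
    by (fastforce simp: valid_plans_def valid_def eligible_plans_def)
  have "valid_plans {} \<subseteq> R `` valid_plans {}"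
    using equiv_R unfolding valid_plans_def valid_def equiv_def refl_on_def by blast
  moreover have "inj_on (\<lambda>\<pi>. R `` {\<pi>}) (valid_plans {})"
    by (rule inj_on_subset[OF _ no_users]) simp
  moreover have "set (level 0) = valid_plans {}"
    using no_users by (auto simp: valid_plans_def)
  ultimately show ?case
    by (simp add: transversal_def del: level.simps)
next
  case (Suc i)
  then have i: "i < length us" and IH: "transversal R (valid_plans (U i)) (set (level i))"
    by auto
  show ?case
    unfolding level.simps
  proof (rule transversal_msort_key[OF equiv_R set_candidates])
    show "valid_plans (U (Suc i)) \<subseteq> R `` set (candidates (U (Suc i)) (us ! i) (level i))"
      using candidates_cover[OF IH nth_notin_U[OF i]] i by (simp only: U_Suc)
  qed (auto simp: key_eq_iff valid_plans_def valid_def)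
qed

lemma count_extensions_level_le:
  "i \<le> length us \<Longrightarrow> count_extensions (level i) \<le> table_size"
  using count_extensions_transversal_le distinct_level transversal_level by blast

end


section \<open>Symbolic execution\<close>

notation Node (infixr "\<cdot>" 65)
notation Pair (infixr "\<star>" 65)

definition wp :: "program \<Rightarrow> tree list \<Rightarrow> expr \<Rightarrow> (tree \<Rightarrow> nat \<Rightarrow> bool) \<Rightarrow> bool" where
  "wp P \<rho> e K \<longleftrightarrow> (\<exists>v t. eval P \<rho> e v t \<and> K v t)"

definition wp_call :: "program \<Rightarrow> nat \<Rightarrow> tree \<Rightarrow> (tree \<Rightarrow> nat \<Rightarrow> bool) \<Rightarrow> bool" where
  "wp_call P f x K \<longleftrightarrow> (\<exists>v t. runs P f x v t \<and> K v t)"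

inductive_cases eval_VarE: "eval P \<rho> (Var i) v t"
inductive_cases eval_EmptyE: "eval P \<rho> Empty v t"
inductive_cases eval_PairE: "eval P \<rho> (a \<star> b) v t"
inductive_cases eval_LeftE: "eval P \<rho> (Left a) v t"
inductive_cases eval_RightE: "eval P \<rho> (Right a) v t"
inductive_cases eval_CondE: "eval P \<rho> (Cond c a b) v t"
inductive_cases eval_CallE: "eval P \<rho> (Call f a) v t"

lemma wp_Var [simp]: "wp P \<rho> (Var i) K \<longleftrightarrow> i < length \<rho> \<and> K (\<rho> ! i) 1"
  unfolding wp_def by (fastforce elim!: eval_VarE intro: eval.Var)

lemma wp_Empty [simp]: "wp P \<rho> Empty K \<longleftrightarrow> K Leaf 1"
  unfolding wp_def by (fastforce elim!: eval_EmptyE intro: eval.Empty)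

lemma wp_Pair [simp]:
  "wp P \<rho> (a \<star> b) K \<longleftrightarrow> wp P \<rho> a (\<lambda>v s. wp P \<rho> b (\<lambda>w t. K (v \<cdot> w) (s + t + 1)))"
  unfolding wp_def by (fastforce elim!: eval_PairE intro: eval.Pair)

lemma wp_Left [simp]: "wp P \<rho> (Left a) K \<longleftrightarrow> wp P \<rho> a (\<lambda>v t. K (left v) (t + 1))"
  unfolding wp_def by (fastforce elim!: eval_LeftE intro: eval.Left)

lemma wp_Right [simp]: "wp P \<rho> (Right a) K \<longleftrightarrow> wp P \<rho> a (\<lambda>v t. K (right v) (t + 1))"
  unfolding wp_def by (fastforce elim!: eval_RightE intro: eval.Right)

lemma wp_Cond [simp]:
  "wp P \<rho> (Cond c a b) K \<longleftrightarrow>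
     wp P \<rho> c (\<lambda>x s. wp P \<rho> (if x = Leaf then b else a) (\<lambda>v t. K v (s + t + 1)))"
proof
  assume "wp P \<rho> (Cond c a b) K"
  then show "wp P \<rho> c (\<lambda>x s. wp P \<rho> (if x = Leaf then b else a) (\<lambda>v t. K v (s + t + 1)))"
    unfolding wp_def by (fastforce elim!: eval_CondE)
next
  assume "wp P \<rho> c (\<lambda>x s. wp P \<rho> (if x = Leaf then b else a) (\<lambda>v t. K v (s + t + 1)))"
  then obtain x s v t where "eval P \<rho> c x s" "eval P \<rho> (if x = Leaf then b else a) v t"
    "K v (s + t + 1)"
    unfolding wp_def by blast
  then show "wp P \<rho> (Cond c a b) K"
    unfolding wp_def by (cases x) (fastforce dest: eval.Cond_Leaf eval.Cond_Node)+
qed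

lemma wp_Call [simp]:
  "wp P \<rho> (Call f a) K \<longleftrightarrow> wp P \<rho> a (\<lambda>v s. wp_call P f v (\<lambda>w t. K w (s + t + 1)))"
  unfolding wp_def wp_call_def runs_def by (fastforce elim!: eval_CallE intro: eval.Call)

text \<open>Continuations must stay untouched until the value passed to them is known.\<close>

lemma wp_weak_cong [cong]: "e = e' \<Longrightarrow> wp P \<rho> e K \<longleftrightarrow> wp P \<rho> e' K"
  by simp

lemma wp_call_weak_cong [cong]: "x = x' \<Longrightarrow> wp_call P f x K \<longleftrightarrow> wp_call P f x' K"
  by simp

lemma computes_within_iff_wp_call:
  "computes_within P f x v B \<longleftrightarrow> wp_call P f x (\<lambda>v' t. v' = v \<and> t \<le> B)"
  unfolding computes_within_def wp_call_def by auto

definition running_time :: "program \<Rightarrow> nat \<Rightarrow> tree \<Rightarrow> nat" where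
  "running_time P f x = (THE t. \<exists>v. runs P f x v t)"

lemma computes_withinD:
  assumes "computes_within P f x v B"
  shows "wp_call P f x K \<longleftrightarrow> K v (running_time P f x)" "running_time P f x \<le> B"
proof -
  from assms obtain t where t: "t \<le> B" "runs P f x v t"
    unfolding computes_within_def by blast
  have unique: "v' = v \<and> t' = t" if "runs P f x v' t'" for v' t'
    using that t(2) unfolding runs_def by (metis eval_deterministic)
  then have "running_time P f x = t"
    unfolding running_time_def using t(2) by blast
  with t unique show "wp_call P f x K \<longleftrightarrow> K v (running_time P f x)" "running_time P f x \<le> B"
    unfolding wp_call_def by blast+
qed

lemma computes_within_mono: "computes_within P f x v B \<Longrightarrow> B \<le> B' \<Longrightarrow> computes_within P f x v B'"
  unfolding computes_within_def by (meson le_trans)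

lemma eval_append: "eval P \<rho> e v t \<Longrightarrow> eval (P @ Q) \<rho> e v t"
proof (induction rule: eval.induct)
  case (Call \<rho> a v s f w t)
  then show ?case by (intro eval.Call) (auto simp: nth_append)
qed (blast intro: eval.intros)+

lemma computes_within_append:
  "computes_within P f x v B \<Longrightarrow> computes_within (P @ Q) f x v B"
  unfolding computes_within_def runs_def by (auto simp: nth_append dest: eval_append)

lemma bool_tree_simps [simp]: "bool_tree True = Leaf \<cdot> Leaf" "bool_tree False = Leaf"
  by (simp_all add: bool_tree_def)

lemma bool_tree_eq_Leaf [simp]: "bool_tree b = Leaf \<longleftrightarrow> \<not> b"
  by (simp add: bool_tree_def)

lemma num_tree_0 [simp]: "num_tree 0 = Leaf"
  and num_tree_Suc [simp]: "num_tree (Suc i) = Leaf \<cdot> num_tree i"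
  by (simp_all add: num_tree_def)

lemma list_tree_eq_Leaf [simp]: "list_tree xs = Leaf \<longleftrightarrow> xs = []"
  by (cases xs) auto

lemma right_list_tree [simp]: "right (list_tree xs) = list_tree (tl xs)"
  by (cases xs) auto


section \<open>The program\<close>

datatype routine =
    Prefix | Authorized | Constraints | Check | Prepend | Branch | Extend | Filter_Valid
  | Candidates | Support | Less | Le | Merge | Every_Other | Sort | Loop | Full | Find | Main

definition routines :: "routine list" where
  "routines = [Prefix, Authorized, Constraints, Check, Prepend, Branch, Extend, Filter_Valid,
     Candidates, Support, Less, Le, Merge, Every_Other, Sort, Loop, Full, Find, Main]"

abbreviation (input) "on_pair F \<equiv> F (Left (Var 0)) (Right (Var 0))"
abbreviation (input) "on_triple F \<equiv> F (Left (Var 0)) (Left (Right (Var 0))) (Right (Right (Var 0)))"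
abbreviation (input) "on_quadruple F \<equiv> F (Left (Var 0)) (Left (Right (Var 0)))
  (Left (Right (Right (Var 0)))) (Right (Right (Right (Var 0))))"
abbreviation (input) "on_arg F \<equiv> F (Var 0)"
abbreviation (input) "truth \<equiv> Empty \<star> Empty"

locale linkage =
  fixes ix :: "routine \<Rightarrow> nat" and fa fc fe fo :: nat
begin

abbreviation (input) "call r \<equiv> Call (ix r)"

text \<open>
  The instance tree \<open>I\<close> consists of its description \<open>D\<close> and the numbers of users, tasks and
  constraints. A \<open>row\<close> is the table of values of a plan along the tasks, and \<open>e\<close> is a table entry.
  \<open>Loop\<close> gets the number \<open>r\<close> of remaining users and the number \<open>i\<close> of users already processed.
\<close>

primrec body :: "routine \<Rightarrow> expr" where
  "body Prefix = on_pair (\<lambda>n i.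
     Cond n (Cond i truth Empty \<star> call Prefix (Right n \<star> Right i)) Empty)"
| "body Authorized = on_triple (\<lambda>D i row.
     Cond row
       (Cond (Cond (Left row) (Call fa (D \<star> i \<star> Right (Left row))) truth)
          (call Authorized (D \<star> (Empty \<star> i) \<star> Right row))
          Empty)
       truth)"
| "body Constraints = on_triple (\<lambda>D j plan.
     Cond j
       (Cond (Call fc (D \<star> Right j \<star> plan)) (call Constraints (D \<star> Right j \<star> plan)) Empty)
       truth)"
| "body Check = on_pair (\<lambda>I plan.
     Cond (call Authorized (Left I \<star> Empty \<star> Right plan))
       (call Constraints (Left I \<star> Right (Right (Right I)) \<star> plan))
       Empty)"
| "body Prepend = on_triple (\<lambda>e rows out.
     Cond rows ((e \<star> Left rows) \<star> call Prepend (e \<star> Right rows \<star> out)) out)"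
| "body Branch = on_triple (\<lambda>e e' rows.
     Cond e'
       (call Prepend (e' \<star> rows \<star> Empty))
       (call Prepend (e \<star> rows \<star> call Prepend (Empty \<star> rows \<star> Empty))))"
| "body Extend = on_pair (\<lambda>e row.
     Cond row (call Branch (e \<star> Left row \<star> call Extend (e \<star> Right row))) truth)"
| "body Filter_Valid = on_quadruple (\<lambda>I X rows out.
     Cond rows
       (Cond (call Check (I \<star> X \<star> Left rows))
          ((X \<star> Left rows) \<star> call Filter_Valid (I \<star> X \<star> Right rows \<star> out))
          (call Filter_Valid (I \<star> X \<star> Right rows \<star> out)))
       out)"
| "body Candidates = on_quadruple (\<lambda>I X e plans.
     Cond plans
       (call Filter_Valid (I \<star> X \<star> call Extend (e \<star> Right (Left plans)) \<star>
          call Candidates (I \<star> X \<star> e \<star> Right plans)))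
       Empty)"
| "body Support = on_arg (\<lambda>row.
     Cond row (Cond (Left row) truth Empty \<star> call Support (Right row)) Empty)"
| "body Less = on_pair (\<lambda>row row'.
     Cond row
       (Cond (Left row)
          (Cond (Left row') (call Less (Right row \<star> Right row')) Empty)
          (Cond (Left row') truth (call Less (Right row \<star> Right row'))))
       Empty)"
| "body Le = on_triple (\<lambda>D plan plan'.
     Cond (call Less (Right plan \<star> Right plan'))
       truth
       (Cond (call Less (Right plan' \<star> Right plan))
          Empty
          (Call fo (D \<star> Left plan \<star> call Support (Right plan) \<star>
             Call fe (D \<star> plan) \<star> Call fe (D \<star> plan')))))"
| "body Merge = on_triple (\<lambda>D xs ys.
     Cond xs
       (Cond ys
          (Cond (call Le (D \<star> Left xs \<star> Left ys))
             (Cond (call Le (D \<star> Left ys \<star> Left xs))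
                (call Merge (D \<star> Right xs \<star> ys))
                (Left xs \<star> call Merge (D \<star> Right xs \<star> ys)))
             (Left ys \<star> call Merge (D \<star> xs \<star> Right ys)))
          xs)
       ys)"
| "body Every_Other = on_arg (\<lambda>xs.
     Cond xs (Left xs \<star> call Every_Other (Right (Right xs))) Empty)"
| "body Sort = on_pair (\<lambda>D xs.
     Cond (Right xs)
       (call Merge (D \<star> call Sort (D \<star> call Every_Other xs) \<star>
          call Sort (D \<star> call Every_Other (Right xs))))
       xs)"
| "body Loop = on_quadruple (\<lambda>I r i plans.
     Cond r
       (call Loop (I \<star> Right r \<star> (Empty \<star> i) \<star>
          call Sort (Left I \<star> call Candidates
            (I \<star> call Prefix (Left (Right I) \<star> Empty \<star> i) \<star> (Empty \<star> i) \<star> plans))))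
       plans)"
| "body Full = on_arg (\<lambda>row. Cond row (Cond (Left row) (call Full (Right row)) Empty) truth)"
| "body Find = on_arg (\<lambda>plans.
     Cond plans
       (Cond (call Full (Right (Left plans))) (Empty \<star> Left plans) (call Find (Right plans)))
       Empty)"
| "body Main = on_arg (\<lambda>I.
     call Find (call Loop (I \<star> Left (Right I) \<star> Empty \<star>
       call Filter_Valid (I \<star> call Prefix (Left (Right I) \<star> Empty) \<star>
         (Left (Right (Right I)) \<star> Empty) \<star> Empty))))"

end

locale solver = linkage +
  fixes P :: program
  assumes ix_less: "ix r < length P"
    and nth_ix: "P ! ix r = body r"
begin

abbreviation computes :: "routine \<Rightarrow> tree \<Rightarrow> tree \<Rightarrow> nat \<Rightarrow> bool" where
  "computes r \<equiv> computes_within P (ix r)"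

lemma wp_call_ix: "wp_call P (ix r) x K \<longleftrightarrow> wp P [x] (body r) K"
  unfolding wp_call_def wp_def runs_def using ix_less nth_ix by auto

lemmas unfold_call = computes_within_iff_wp_call wp_call_ix body.simps

end

lemma ex_solver: "\<exists>Q ix. solver ix fa fc fe fo (Lib @ Q)"
proof -
  have "\<forall>r. \<exists>i. i < length routines \<and> routines ! i = r"
  proof
    fix r
    have "r \<in> set routines"
      by (cases r) (simp_all add: routines_def)
    then show "\<exists>i. i < length routines \<and> routines ! i = r"
      by (simp add: in_set_conv_nth)
  qed
  then obtain position where
    position: "\<And>r. position r < length routines \<and> routines ! position r = r"
    by metis
  define ix where "ix r = length Lib + position r" for r
  have "solver ix fa fc fe fo (Lib @ map (linkage.body ix fa fc fe fo) routines)"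
    by unfold_locales (simp_all add: ix_def position nth_append)
  then show ?thesis by blast
qed


section \<open>Tables\<close>

definition entry :: "'u list \<Rightarrow> 'u option \<Rightarrow> tree" where
  "entry us z = (case z of None \<Rightarrow> Leaf | Some u \<Rightarrow> Leaf \<cdot> user_tree us u)"

definition row :: "'u list \<Rightarrow> 's list \<Rightarrow> ('s \<rightharpoonup> 'u) \<Rightarrow> tree" where
  "row us ss f = list_tree (map (\<lambda>s. entry us (f s)) ss)"

lemma plan_tree_eq: "plan_tree ss us \<pi> = set_tree us (users \<pi>) \<cdot> row us ss (snd \<pi>)"
  by (simp add: plan_tree_def row_def entry_def)

lemma entry_eq_Leaf [simp]: "entry us z = Leaf \<longleftrightarrow> z = None"
  by (simp add: entry_def split: option.split)

lemma entry_None [simp]: "entry us None = Leaf"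
  and right_entry_Some [simp]: "right (entry us (Some u)) = user_tree us u"
  by (simp_all add: entry_def)

lemma row_Nil [simp]: "row us [] f = Leaf"
  and row_Cons [simp]: "row us (s # ss) f = entry us (f s) \<cdot> row us ss f"
  by (simp_all add: row_def)

lemma row_cong: "(\<And>s. s \<in> set ss \<Longrightarrow> f s = g s) \<Longrightarrow> row us ss f = row us ss g"
  by (simp add: row_def cong: map_cong)

lemma row_empty: "row us ss Map.empty = num_tree (length ss)"
  by (simp add: row_def num_tree_def map_replicate_const)

definition support :: "'s list \<Rightarrow> ('s \<rightharpoonup> 'u) \<Rightarrow> bool list" where
  "support ss f = map (\<lambda>s. f s \<noteq> None) ss"

lemma support_Nil [simp]: "support [] f = []"
  and support_Cons [simp]: "support (s # ss) f = (f s \<noteq> None) # support ss f"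
  by (simp_all add: support_def)

lemma support_eq_iff:
  assumes "dom f \<subseteq> set ss" "dom g \<subseteq> set ss"
  shows "support ss f = support ss g \<longleftrightarrow> dom f = dom g"
  using assms unfolding support_def map_eq_conv domIff[symmetric] by blast

lemma user_tree_eq_num_tree: "u \<in> set us \<Longrightarrow> \<exists>j<length us. us ! j = u \<and> user_tree us u = num_tree j"
  unfolding user_tree_def in_set_conv_nth by (metis (mono_tags, lifting) LeastI_ex)

lemma entry_nth:
  assumes "distinct us" "i < length us"
  shows "entry us (Some (us ! i)) = num_tree (Suc i)"
proof -
  obtain j where "j < length us" "us ! j = us ! i" "user_tree us (us ! i) = num_tree j"
    using user_tree_eq_num_tree[of "us ! i" us] assms(2) by auto
  then show ?thesis
    using assms by (simp add: entry_def nth_eq_iff_index_eq)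
qed

lemma set_tree_take:
  assumes "distinct us"
  shows "set_tree us (set (take i us)) = list_tree (map (\<lambda>j. bool_tree (j < i)) [0..<length us])"
proof -
  have "us ! j \<in> set (take i us) \<longleftrightarrow> j < i" if "j < length us" for j
    using assms that by (auto simp: in_set_conv_nth nth_eq_iff_index_eq)
  then have "map (\<lambda>x. bool_tree (x \<in> set (take i us))) us =
      map (\<lambda>j. bool_tree (j < i)) [0..<length us]"
    by (intro nth_equalityI) auto
  then show ?thesis by (simp add: set_tree_def)
qed


section \<open>Routines on lists and tables\<close>

definition sort_cost :: "nat \<Rightarrow> nat" where
  "sort_cost B = 4 * B + 500"

context solver
begin

lemma computes_Prefix:
  "computes Prefix (num_tree n \<cdot> num_tree i) (list_tree (map (\<lambda>j. bool_tree (j < i)) [0..<n]))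
     (30 * (n + 1))"
proof (induction n arbitrary: i)
  case 0
  show ?case unfolding unfold_call by simp
next
  case (Suc n)
  have prefix: "map (\<lambda>j. bool_tree (j < i)) [0..<Suc n] =
      bool_tree (0 < i) # map (\<lambda>j. bool_tree (j < i - 1)) [0..<n]"
    by (simp add: map_upt_Suc del: upt_Suc) (auto intro!: arg_cong[where f = bool_tree])
  show ?case
    unfolding unfold_call prefix using computes_withinD[OF Suc.IH[of "i - 1"]]
    by (cases i) simp_all
qed

lemma computes_Authorized:
  assumes "\<And>j u. j < length ss \<Longrightarrow> f (ss ! j) = Some u \<Longrightarrow>
      computes_within P fa (D \<cdot> num_tree (i + j) \<cdot> user_tree us u) (bool_tree (u \<in> A (ss ! j))) B"
  shows "computes Authorized (D \<cdot> num_tree i \<cdot> row us ss f)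
     (bool_tree (\<forall>s\<in>set ss. \<forall>u. f s = Some u \<longrightarrow> u \<in> A s)) ((B + 60) * (length ss + 1))"
  using assms
proof (induction ss arbitrary: i)
  case Nil
  show ?case unfolding unfold_call by simp
next
  case (Cons s ss)
  have IH: "computes Authorized (D \<cdot> num_tree (Suc i) \<cdot> row us ss f)
     (bool_tree (\<forall>s\<in>set ss. \<forall>u. f s = Some u \<longrightarrow> u \<in> A s)) ((B + 60) * (length ss + 1))"
    by (rule Cons.IH) (use Cons.prems[of "Suc _"] in simp)
  show ?case
  proof (cases "f s")
    case None
    then show ?thesis
      unfolding unfold_call using computes_withinD[OF IH] by simp
  next
    case (Some u)
    then have head: "computes_within P fa (D \<cdot> num_tree i \<cdot> user_tree us u) (bool_tree (u \<in> A s)) B"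
      using Cons.prems[of 0 u] by simp
    show ?thesis
      unfolding unfold_call using computes_withinD[OF head] computes_withinD[OF IH] Some
      by (cases "u \<in> A s") simp_all
  qed
qed

lemma computes_Constraints:
  assumes "\<And>i. i < j \<Longrightarrow> computes_within P fc (D \<cdot> num_tree i \<cdot> x) (bool_tree (Q i)) B"
  shows "computes Constraints (D \<cdot> num_tree j \<cdot> x) (bool_tree (\<forall>i<j. Q i)) ((B + 60) * (j + 1))"
  using assms
proof (induction j)
  case 0
  show ?case unfolding unfold_call by simp
next
  case (Suc j)
  have IH: "computes Constraints (D \<cdot> num_tree j \<cdot> x) (bool_tree (\<forall>i<j. Q i)) ((B + 60) * (j + 1))"
    using Suc by simp
  show ?case
    unfolding unfold_call All_less_Suc
    using computes_withinD[OF IH] computes_withinD[OF Suc.prems[of j]]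
    by (cases "Q j") simp_all
qed

lemma computes_Prepend:
  "computes Prepend (e \<cdot> list_tree rows \<cdot> list_tree out) (list_tree (map ((\<cdot>) e) rows @ out))
     (40 * (length rows + 1))"
proof (induction rows)
  case Nil
  show ?case unfolding unfold_call by simp
next
  case (Cons r rows)
  show ?case unfolding unfold_call using computes_withinD[OF Cons.IH] by simp
qed

lemma computes_Branch:
  "computes Branch (e \<cdot> e' \<cdot> list_tree rows)
     (list_tree (if e' = Leaf then map ((\<cdot>) e) rows @ map ((\<cdot>) Leaf) rows else map ((\<cdot>) e') rows))
     (80 * (length rows + 1) + 60)"
proof -
  have prepend: "computes Prepend (x \<cdot> list_tree rows \<cdot> Leaf) (list_tree (map ((\<cdot>) x) rows))
      (40 * (length rows + 1))" for x
    using computes_Prepend[of x rows "[]"] by simp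
  show ?thesis
    unfolding unfold_call
    using computes_withinD[OF prepend[of e']] computes_withinD[OF prepend[of Leaf]]
      computes_withinD[OF computes_Prepend[of e rows "map ((\<cdot>) Leaf) rows"]]
    by simp
qed

lemma computes_Extend:
  "distinct ss \<Longrightarrow> computes Extend (entry us (Some u) \<cdot> row us ss f)
     (list_tree (map (row us ss) (extensions u ss f)))
     (300 * (length ss + 1) * length (extensions u ss f))"
proof (induction ss)
  case Nil
  show ?case unfolding unfold_call by simp
next
  case (Cons s ss)
  let ?E = "extensions u ss f"
  have s: "s \<notin> set ss" and IH: "computes Extend (entry us (Some u) \<cdot> row us ss f)
     (list_tree (map (row us ss) ?E)) (300 * (length ss + 1) * length ?E)"
    using Cons by simp_all
  have old: "map (row us (s # ss)) ?E = map ((\<cdot>) (entry us (f s))) (map (row us ss) ?E)"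
    using extensions_apply_notin[of _ u ss f s] s by auto
  have new: "map (row us (s # ss)) (map (\<lambda>g. g(s \<mapsto> u)) ?E) =
      map ((\<cdot>) (entry us (Some u))) (map (row us ss) ?E)"
    using s by (auto intro!: row_cong)
  have rows: "map (row us (s # ss)) (extensions u (s # ss) f) =
      (if entry us (f s) = Leaf
       then map ((\<cdot>) (entry us (Some u))) (map (row us ss) ?E) @ map ((\<cdot>) Leaf) (map (row us ss) ?E)
       else map ((\<cdot>) (entry us (f s))) (map (row us ss) ?E))"
    by (cases "f s") (simp_all add: old new del: map_map)
  note branch = computes_Branch[of "entry us (Some u)" "entry us (f s)" "map (row us ss) ?E",
      folded rows]
  obtain z where "length ?E = Suc z"
    using gr0_implies_Suc[OF length_extensions_pos[of u ss f]] by blast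
  then show ?case
    unfolding unfold_call using computes_withinD[OF IH] computes_withinD[OF branch]
    by (cases "f s") (simp_all add: algebra_simps del: list.map)
qed

lemma computes_Support:
  "computes Support (row us ss f) (set_tree ss (dom f)) (30 * (length ss + 1))"
proof (induction ss)
  case Nil
  show ?case unfolding unfold_call by (simp add: set_tree_def)
next
  case (Cons s ss)
  show ?case
    unfolding unfold_call using computes_withinD[OF Cons.IH]
    by (cases "f s") (simp_all add: set_tree_def domIff)
qed

lemma computes_Less:
  "computes Less (row us ss f \<cdot> row us ss g) (bool_tree (support ss f < support ss g))
     (60 * (length ss + 1))"
proof (induction ss)
  case Nil
  show ?case unfolding unfold_call by simp
next
  case (Cons s ss)
  show ?case
    unfolding unfold_call using computes_withinD[OF Cons.IH] by (cases "f s"; cases "g s") simp_all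
qed

lemma computes_Full:
  "computes Full (row us ss f) (bool_tree (set ss \<subseteq> dom f)) (30 * (length ss + 1))"
proof (induction ss)
  case Nil
  show ?case unfolding unfold_call by simp
next
  case (Cons s ss)
  show ?case
    unfolding unfold_call using computes_withinD[OF Cons.IH]
    by (cases "f s") (simp_all add: domIff)
qed

lemma computes_Find:
  "computes Find (list_tree (map (plan_tree ss us) \<pi>s))
     (case find (\<lambda>\<pi>. set ss \<subseteq> tasks \<pi>) \<pi>s of None \<Rightarrow> Leaf | Some \<pi> \<Rightarrow> Leaf \<cdot> plan_tree ss us \<pi>)
     (60 * (length ss + 1) * (length \<pi>s + 1))"
proof (induction \<pi>s)
  case Nil
  show ?case unfolding unfold_call by simp
next
  case (Cons \<pi> \<pi>s)
  show ?case
    unfolding unfold_call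
    using computes_withinD[OF Cons.IH] computes_withinD[OF computes_Full[of us ss "snd \<pi>"]]
    by (cases "set ss \<subseteq> tasks \<pi>") (simp_all add: plan_tree_eq[of ss us \<pi>] algebra_simps)
qed

lemma computes_Merge:
  assumes "\<And>x y. x \<in> Z \<Longrightarrow> y \<in> Z \<Longrightarrow>
      computes Le (D \<cdot> c x \<cdot> c y) (bool_tree (key x \<le> key y)) B"
    and "set xs \<subseteq> Z" "set ys \<subseteq> Z"
  shows "computes Merge (D \<cdot> list_tree (map c xs) \<cdot> list_tree (map c ys))
     (list_tree (map c (merge_key key xs ys))) ((2 * B + 120) * (length xs + length ys + 1))"
  using assms
proof (induction key xs ys rule: merge_key.induct)
  case (1 key ys)
  show ?case unfolding unfold_call by simp
next
  case (2 key x xs)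
  show ?case unfolding unfold_call by simp
next
  case (3 key x xs y ys)
  note le = "3.prems"(1)
  have Z: "x \<in> Z" "y \<in> Z" "set xs \<subseteq> Z" "set ys \<subseteq> Z"
    using "3.prems" by auto
  note compare = computes_withinD[OF le[OF Z(1,2)]] computes_withinD[OF le[OF Z(2,1)]]
  consider "key x \<le> key y" "key y \<le> key x" | "key x \<le> key y" "\<not> key y \<le> key x"
    | "\<not> key x \<le> key y"
    by blast
  then show ?case
  proof cases
    case eq: 1
    show ?thesis
      unfolding unfold_call using eq compare computes_withinD[OF "3.IH"(1)[OF eq le]] Z
      by (simp add: algebra_simps)
  next
    case less: 2
    show ?thesis
      unfolding unfold_call using less compare computes_withinD[OF "3.IH"(2)[OF less le]] Z
      by (simp add: algebra_simps)
  next
    case greater: 3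
    show ?thesis
      unfolding unfold_call using greater compare computes_withinD[OF "3.IH"(3)[OF greater le]] Z
      by (simp add: algebra_simps)
  qed
qed

lemma computes_Every_Other:
  "computes Every_Other (list_tree xs) (list_tree (every_other xs)) (20 * (length xs + 1))"
proof (induction xs rule: every_other.induct)
  case 1
  show ?case unfolding unfold_call by simp
next
  case (2 x xs)
  show ?case unfolding unfold_call using computes_withinD[OF "2.IH"] by (cases xs) simp_all
qed

lemma sort_time_recurrence:
  assumes "y + z = N" "p \<le> N" "1 \<le> N"
  shows "40 * (N + 1) + (sort_cost B * (d + 1) * y + 20) + (sort_cost B * (d + 1) * z + 20) +
    (2 * B + 120) * (p + 1) + 60 \<le> sort_cost B * (Suc d + 1) * N + 20"
proof -
  have "(2 * B + 120) * (p + 1) \<le> (2 * B + 120) * (2 * N)"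
    using assms(2,3) by (intro mult_le_mono2) simp
  then have "40 * (N + 1) + (2 * B + 120) * (p + 1) + 80 \<le> sort_cost B * N"
    using assms(3) by (simp add: sort_cost_def algebra_simps)
  moreover have "sort_cost B * (Suc d + 1) * N =
      sort_cost B * (d + 1) * y + sort_cost B * (d + 1) * z + sort_cost B * N"
    by (simp add: algebra_simps flip: assms(1))
  ultimately show ?thesis by linarith
qed

lemma computes_Sort:
  assumes le: "\<And>x y. x \<in> Z \<Longrightarrow> y \<in> Z \<Longrightarrow>
      computes Le (D \<cdot> c x \<cdot> c y) (bool_tree (key x \<le> key y)) B"
    and "set xs \<subseteq> Z" "length xs \<le> 2 ^ d"
  shows "computes Sort (D \<cdot> list_tree (map c xs)) (list_tree (map c (msort_key key xs)))
     (sort_cost B * (d + 1) * length xs + 20)"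
  using assms(2,3)
proof (induction d arbitrary: xs)
  case 0
  then show ?case
    unfolding unfold_call by (cases xs) (simp_all add: msort_key_short)
next
  case (Suc d)
  show ?case
  proof (cases "tl xs = []")
    case True
    then show ?thesis
      unfolding unfold_call by (cases xs) (simp_all add: msort_key_short)
  next
    case False
    let ?ys = "every_other xs" and ?zs = "every_other (tl xs)"
    have sub: "set ?ys \<subseteq> Z" "set ?zs \<subseteq> Z"
      using Suc.prems(1) set_every_other[of xs] by blast+
    have "length ?ys \<le> 2 ^ d" "length ?zs \<le> 2 ^ d"
      using Suc.prems(2) by (simp_all add: length_every_other)
    note halves = Suc.IH[OF sub(1) this(1)] Suc.IH[OF sub(2) this(2)]
    have "set (msort_key key ?ys) \<subseteq> Z" "set (msort_key key ?zs) \<subseteq> Z"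
      using sub set_msort_key[of key ?ys] set_msort_key[of key ?zs] by auto
    note merge = computes_Merge[where c = c and key = key, OF le this]
    note split = computes_Every_Other[of "map c xs"] computes_Every_Other[of "tl (map c xs)"]
    have "length (msort_key key ?ys) + length (msort_key key ?zs) \<le> length xs"
      using add_mono[OF length_msort_key length_msort_key, of key ?ys key ?zs]
      by (simp only: length_every_other_tl)
    from sort_time_recurrence[OF length_every_other_tl this, of B d] show ?thesis
      unfolding unfold_call msort_key_split[OF False]
      using False computes_withinD[OF split(1)] computes_withinD[OF split(2)]
        computes_withinD[OF halves(1)] computes_withinD[OF halves(2)] computes_withinD[OF merge]
      by (cases xs) (simp_all add: map_every_other flip: map_tl)
  qed
qed

end


section \<open>Ranking the codes\<close>

lemma card_under_le_iff:
  assumes "finite E" "linear_order_on E r" "a \<in> E" "b \<in> E"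
  shows "card (under r a) \<le> card (under r b) \<longleftrightarrow> (a, b) \<in> r"
proof
  have r: "trans r" "total_on E r" "refl_on E r" "r \<subseteq> E \<times> E"
    using assms(2) by (auto simp: linear_order_on_def dest: partial_order_onD)
  then have fin: "finite (under r x)" for x
    using assms(1) by (auto simp: under_def intro: finite_subset[of _ E])
  show "card (under r a) \<le> card (under r b)" if "(a, b) \<in> r"
    using card_mono[OF fin under_incr[OF r(1) that]] .
  show "(a, b) \<in> r" if le: "card (under r a) \<le> card (under r b)"
  proof (rule ccontr)
    assume ab: "(a, b) \<notin> r"
    then have "(b, a) \<in> r"
      using r(2,3) assms(3,4) unfolding total_on_def by (metis refl_onD)
    then have "under r b \<subset> under r a"
      using under_incr[OF r(1)] ab assms(3) r(3) by (auto simp: under_def dest: refl_onD)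
    with le show False
      using psubset_card_mono[OF fin] by (meson leD)
  qed
qed

lemma card_under_eq_iff:
  assumes "finite E" "linear_order_on E r" "a \<in> E" "b \<in> E"
  shows "card (under r a) = card (under r b) \<longleftrightarrow> a = b"
proof
  assume "card (under r a) = card (under r b)"
  then have "(a, b) \<in> r" "(b, a) \<in> r"
    using card_under_le_iff[OF assms] card_under_le_iff[OF assms(1,2,4,3)] by simp_all
  moreover have "antisym r"
    using assms(2) by (simp add: linear_order_on_def partial_order_on_def)
  ultimately show "a = b"
    by (rule antisymD[rotated])
qed simp

lemma encoding_within_computes_enc:
  assumes "encoding_within P fe fo B D ss us C R enc" "eligible (set ss) (set us) C \<pi>"
  shows "computes_within P fe (D \<cdot> plan_tree ss us \<pi>) (enc \<pi>) B"
proof -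
  have "\<pi> \<in> eligible_plans (set ss) (set us) C (users \<pi>) (tasks \<pi>)"
    "users \<pi> \<subseteq> set us" "tasks \<pi> \<subseteq> set ss"
    using assms(2) by (simp_all add: eligible_plans_def eligible_def is_plan_def)
  then show ?thesis
    using assms(1) unfolding encoding_within_def Let_def by meson
qed

lemma encoding_within_ex_code_rank:
  assumes "encoding_within P fe fo B D ss us C R enc" and XT: "X \<subseteq> set us" "T \<subseteq> set ss"
  defines "\<Pi> \<equiv> eligible_plans (set ss) (set us) C X T"
  shows "\<exists>code_rank :: tree \<Rightarrow> nat. \<forall>\<pi>\<in>\<Pi>. \<forall>\<pi>'\<in>\<Pi>.
    computes_within P fo (D \<cdot> set_tree us X \<cdot> set_tree ss T \<cdot> enc \<pi> \<cdot> enc \<pi>')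
      (bool_tree (code_rank (enc \<pi>) \<le> code_rank (enc \<pi>'))) B \<and>
    (code_rank (enc \<pi>) = code_rank (enc \<pi>') \<longleftrightarrow> (\<pi>, \<pi>') \<in> R)"
proof -
  note encoding = assms(1)[unfolded encoding_within_def Let_def, rule_format, OF conjI[OF XT],
      folded \<Pi>_def]
  then obtain r where r: "linear_order_on (enc ` \<Pi>) r" and compare: "\<forall>a\<in>enc ` \<Pi>. \<forall>b\<in>enc ` \<Pi>.
      computes_within P fo (D \<cdot> set_tree us X \<cdot> set_tree ss T \<cdot> a \<cdot> b) (bool_tree ((a, b) \<in> r)) B"
    by blast
  have "finite \<Pi>"
    using finite_eligible[of "set ss" "set us" C] by (simp add: \<Pi>_def eligible_plans_def)
  then have fin: "finite (enc ` \<Pi>)"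
    by (rule finite_imageI)
  show ?thesis
  proof (intro exI[of _ "\<lambda>a. card (under r a)"] ballI)
    fix \<pi> \<pi>'
    assume \<pi>: "\<pi> \<in> \<Pi>" "\<pi>' \<in> \<Pi>"
    then have codes: "enc \<pi> \<in> enc ` \<Pi>" "enc \<pi>' \<in> enc ` \<Pi>"
      by simp_all
    show "computes_within P fo (D \<cdot> set_tree us X \<cdot> set_tree ss T \<cdot> enc \<pi> \<cdot> enc \<pi>')
        (bool_tree (card (under r (enc \<pi>)) \<le> card (under r (enc \<pi>')))) B \<and>
      (card (under r (enc \<pi>)) = card (under r (enc \<pi>')) \<longleftrightarrow> (\<pi>, \<pi>') \<in> R)"
      unfolding card_under_le_iff[OF fin r codes] card_under_eq_iff[OF fin r codes]
      using compare codes encoding \<pi> by blast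
  qed
qed

lemma encoding_within_ex_plan_rank:
  assumes "encoding_within P fe fo B D ss us C R (enc :: ('s, 'u) plan \<Rightarrow> tree)"
  shows "\<exists>rank :: ('s, 'u) plan \<Rightarrow> nat. \<forall>X T.
    \<forall>\<pi>\<in>eligible_plans (set ss) (set us) C X T. \<forall>\<pi>'\<in>eligible_plans (set ss) (set us) C X T.
      computes_within P fo (D \<cdot> set_tree us X \<cdot> set_tree ss T \<cdot> enc \<pi> \<cdot> enc \<pi>')
        (bool_tree (rank \<pi> \<le> rank \<pi>')) B \<and>
      (rank \<pi> = rank \<pi>' \<longleftrightarrow> (\<pi>, \<pi>') \<in> R)"
proof -
  let ?\<Pi> = "eligible_plans (set ss) (set us) C"
  have subsets: "X \<subseteq> set us" "T \<subseteq> set ss" if "\<pi> \<in> ?\<Pi> X T" for \<pi> X T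
    using that by (auto simp: eligible_plans_def eligible_def is_plan_def)
  obtain code_rank :: "'u set \<Rightarrow> 's set \<Rightarrow> tree \<Rightarrow> nat" where code_rank:
    "\<And>X T \<pi> \<pi>'. X \<subseteq> set us \<Longrightarrow> T \<subseteq> set ss \<Longrightarrow> \<pi> \<in> ?\<Pi> X T \<Longrightarrow> \<pi>' \<in> ?\<Pi> X T \<Longrightarrow>
      computes_within P fo (D \<cdot> set_tree us X \<cdot> set_tree ss T \<cdot> enc \<pi> \<cdot> enc \<pi>')
        (bool_tree (code_rank X T (enc \<pi>) \<le> code_rank X T (enc \<pi>'))) B \<and>
      (code_rank X T (enc \<pi>) = code_rank X T (enc \<pi>') \<longleftrightarrow> (\<pi>, \<pi>') \<in> R)"
    using encoding_within_ex_code_rank[OF assms] by metis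
  show ?thesis
  proof (intro exI[of _ "\<lambda>\<pi>. code_rank (users \<pi>) (tasks \<pi>) (enc \<pi>)"] allI ballI)
    fix X T \<pi> \<pi>'
    assume \<pi>: "\<pi> \<in> ?\<Pi> X T" "\<pi>' \<in> ?\<Pi> X T"
    then have "users \<pi> = X" "users \<pi>' = X" "tasks \<pi> = T" "tasks \<pi>' = T"
      by (simp_all add: eligible_plans_def)
    then show "computes_within P fo (D \<cdot> set_tree us X \<cdot> set_tree ss T \<cdot> enc \<pi> \<cdot> enc \<pi>')
        (bool_tree (code_rank (users \<pi>) (tasks \<pi>) (enc \<pi>) \<le>
          code_rank (users \<pi>') (tasks \<pi>') (enc \<pi>'))) B \<and>
      (code_rank (users \<pi>) (tasks \<pi>) (enc \<pi>) = code_rank (users \<pi>') (tasks \<pi>') (enc \<pi>') \<longleftrightarrow>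
        (\<pi>, \<pi>') \<in> R)"
      using code_rank[OF subsets[OF \<pi>(1)] \<pi>] by simp
  qed
qed


section \<open>Running time of the solver\<close>

definition check_cost :: "nat \<Rightarrow> nat \<Rightarrow> nat \<Rightarrow> nat" where
  "check_cost B k m = (B + 60) * (k + m + 2) + 60"

definition filter_cost :: "nat \<Rightarrow> nat \<Rightarrow> nat \<Rightarrow> nat" where
  "filter_cost B k m = check_cost B k m + 80"

definition candidates_cost :: "nat \<Rightarrow> nat \<Rightarrow> nat \<Rightarrow> nat" where
  "candidates_cost B k m = 300 * (k + 1) + 2 * filter_cost B k m + 100"

definition le_cost :: "nat \<Rightarrow> nat \<Rightarrow> nat" where
  "le_cost B k = 3 * B + 300 * (k + 1)"

definition level_cost :: "nat \<Rightarrow> nat \<Rightarrow> nat \<Rightarrow> nat \<Rightarrow> nat" where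
  "level_cost B n k m = 30 * (n + 1) + 2 * candidates_cost B k m + sort_cost (le_cost B k) + 200"

definition solve_cost :: "nat \<Rightarrow> nat \<Rightarrow> nat \<Rightarrow> nat \<Rightarrow> nat" where
  "solve_cost B n k m =
     n * level_cost B n k m + 30 * (n + 1) + 2 * filter_cost B k m + 120 * (k + 1) + 300"

lemma level_time_le:
  assumes "1 \<le> M"
  shows "30 * (n + 1) + candidates_cost B k m * (M + 1) +
    (sort_cost (le_cost B k) * (d + 1) * M + 20) + 100 \<le> level_cost B n k m * ((d + 1) * M)"
proof -
  have "M \<le> (d + 1) * M"
    by simp
  with assms have "(30 * (n + 1) + 120) * 1 \<le> (30 * (n + 1) + 200) * ((d + 1) * M)"
    "candidates_cost B k m * (M + 1) \<le> candidates_cost B k m * (2 * ((d + 1) * M))"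
    by (intro mult_le_mono; linarith)+
  then show ?thesis
    unfolding level_cost_def by (simp only: algebra_simps)
qed

lemma solve_time_le:
  assumes "1 \<le> M" "M \<le> F"
  shows "30 * (n + 1) + 2 * filter_cost B k m + (n * (level_cost B n k m * F) + 20) +
    60 * (k + 1) * (M + 1) + 100 \<le> solve_cost B n k m * F"
proof -
  have "(30 * (n + 1) + 2 * filter_cost B k m + 120) * 1 \<le>
      (30 * (n + 1) + 2 * filter_cost B k m + 300) * F"
    "60 * (k + 1) * (M + 1) \<le> 60 * (k + 1) * (2 * F)"
    using assms by (intro mult_le_mono; linarith)+
  then show ?thesis
    unfolding solve_cost_def by (simp only: algebra_simps)
qed

locale wsp_solver = solver ix fa fc fe fo P + wsp ss us cs A R
  for ix fa fc fe fo P and ss :: "'s list" and us :: "'u list" and cs A R +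
  fixes D :: tree and enc :: "('s, 'u) plan \<Rightarrow> tree" and rank :: "('s, 'u) plan \<Rightarrow> nat" and B :: nat
  assumes checkable: "checkable_within P fa fc B D ss us cs A"
    and computes_enc: "eligible_plan \<pi> \<Longrightarrow>
      computes_within P fe (D \<cdot> plan_tree ss us \<pi>) (enc \<pi>) B"
    and computes_rank_le: "\<pi> \<in> \<Pi> X T \<Longrightarrow>
      \<pi>' \<in> \<Pi> X T \<Longrightarrow>
      computes_within P fo (D \<cdot> set_tree us X \<cdot> set_tree ss T \<cdot> enc \<pi> \<cdot> enc \<pi>')
        (bool_tree (rank \<pi> \<le> rank \<pi>')) B"
    and rank_eq_iff: "\<pi> \<in> \<Pi> X T \<Longrightarrow>
      \<pi>' \<in> \<Pi> X T \<Longrightarrow> rank \<pi> = rank \<pi>' \<longleftrightarrow> (\<pi>, \<pi>') \<in> R"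
begin

abbreviation "n \<equiv> length us"
abbreviation "k \<equiv> length ss"
abbreviation "m \<equiv> length cs"
abbreviation "I \<equiv> instance_tree D ss us cs"
abbreviation "pt \<equiv> plan_tree ss us"

definition plan_key :: "('s, 'u) plan \<Rightarrow> bool list \<times> nat" where
  "plan_key \<pi> = (support ss (snd \<pi>), rank \<pi>)"

lemma support_plan_eq_iff:
  "eligible_plan \<pi> \<Longrightarrow> eligible_plan \<pi>' \<Longrightarrow>
     support ss (snd \<pi>) = support ss (snd \<pi>') \<longleftrightarrow> tasks \<pi> = tasks \<pi>'"
  by (rule support_eq_iff) (simp_all add: eligible_def is_plan_def)

sublocale keyed_wsp ss us cs A R plan_key
proof
  fix \<pi> \<pi>'
  assume \<pi>: "eligible_plan \<pi>" "eligible_plan \<pi>'" "users \<pi> = users \<pi>'"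
  have "rank \<pi> = rank \<pi>' \<longleftrightarrow> (\<pi>, \<pi>') \<in> R" if "tasks \<pi> = tasks \<pi>'"
    using \<pi> that by (intro rank_eq_iff[where X = "users \<pi>" and T = "tasks \<pi>"])
      (simp_all add: eligible_plans_def)
  moreover have "tasks \<pi> = tasks \<pi>'" if "(\<pi>, \<pi>') \<in> R"
    using indistinguishable_imp_ext_equiv[OF indist that] by (simp add: ext_equiv_def)
  ultimately show "plan_key \<pi> = plan_key \<pi>' \<longleftrightarrow> (\<pi>, \<pi>') \<in> R"
    unfolding plan_key_def prod.inject support_plan_eq_iff[OF \<pi>(1,2)] by blast
qed

lemma computes_Check:
  assumes \<pi>: "is_plan (set ss) (set us) \<pi>"
  shows "computes Check (I \<cdot> pt \<pi>) (bool_tree (valid_plan \<pi>)) (check_cost B k m)"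
proof -
  have authorized: "authorized A \<pi> \<longleftrightarrow> (\<forall>s\<in>set ss. \<forall>u. snd \<pi> s = Some u \<longrightarrow> u \<in> A s)"
    using \<pi> by (fastforce simp: authorized_def is_plan_def dom_def)
  have eligible: "eligible_plan \<pi> \<longleftrightarrow> (\<forall>i<m. satisfies \<pi> (cs ! i))"
    using \<pi> by (simp add: eligible_def all_set_conv_all_nth)
  have "computes_within P fa (D \<cdot> num_tree (0 + j) \<cdot> user_tree us u) (bool_tree (u \<in> A (ss ! j))) B"
    if "j < k" "snd \<pi> (ss ! j) = Some u" for j u
  proof -
    have "u \<in> set us"
      using \<pi> ranI[of "snd \<pi>", OF that(2)] unfolding is_plan_def by blast
    then obtain l where "l < n" "us ! l = u" "user_tree us u = num_tree l"
      using user_tree_eq_num_tree[of u us] by blast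
    then show ?thesis
      using checkable that(1) unfolding checkable_within_def by auto
  qed
  then have auth: "computes Authorized (D \<cdot> num_tree 0 \<cdot> row us ss (snd \<pi>))
      (bool_tree (authorized A \<pi>)) ((B + 60) * (k + 1))"
    unfolding authorized by (rule computes_Authorized)
  have "computes_within P fc (D \<cdot> num_tree i \<cdot> pt \<pi>) (bool_tree (satisfies \<pi> (cs ! i))) B"
    if "i < m" for i
    using checkable that \<pi> unfolding checkable_within_def by blast
  then have constr: "computes Constraints (D \<cdot> num_tree m \<cdot> pt \<pi>)
      (bool_tree (eligible_plan \<pi>)) ((B + 60) * (m + 1))"
    unfolding eligible by (rule computes_Constraints)
  show ?thesis
    unfolding unfold_call instance_tree_def valid_def check_cost_def
    using computes_withinD[OF auth] computes_withinD[OF constr]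
    by (cases "authorized A \<pi>") (simp_all add: plan_tree_eq algebra_simps)
qed

lemma computes_Le:
  assumes \<pi>: "eligible_plan \<pi>" "users \<pi> = X" and \<pi>': "eligible_plan \<pi>'" "users \<pi>' = X"
  shows "computes Le (D \<cdot> pt \<pi> \<cdot> pt \<pi>') (bool_tree (plan_key \<pi> \<le> plan_key \<pi>'))
     (le_cost B k)"
proof -
  note compare = computes_withinD[OF computes_Less[of us ss "snd \<pi>" "snd \<pi>'"]]
    computes_withinD[OF computes_Less[of us ss "snd \<pi>'" "snd \<pi>"]]
  note support = computes_withinD[OF computes_Support[of us ss "snd \<pi>"]]
  note enc = computes_withinD[OF computes_enc[OF \<pi>(1)], unfolded plan_tree_eq]
    computes_withinD[OF computes_enc[OF \<pi>'(1)], unfolded plan_tree_eq]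
  consider "support ss (snd \<pi>) < support ss (snd \<pi>')"
    | "support ss (snd \<pi>') < support ss (snd \<pi>)"
    | "support ss (snd \<pi>) = support ss (snd \<pi>')"
    by (rule linorder_cases)
  then show ?thesis
  proof cases
    case less: 1
    then show ?thesis
      unfolding unfold_call plan_key_def plan_tree_eq le_cost_def using compare by simp
  next
    case greater: 2
    then have "\<not> support ss (snd \<pi>) \<le> support ss (snd \<pi>')"
      by simp
    with greater show ?thesis
      unfolding unfold_call plan_key_def plan_tree_eq le_cost_def using compare by simp
  next
    case eq: 3
    then have "tasks \<pi> = tasks \<pi>'"
      using support_plan_eq_iff[OF \<pi>(1) \<pi>'(1)] by blast
    then have "computes_within P fo (D \<cdot> set_tree us X \<cdot> set_tree ss (tasks \<pi>) \<cdot> enc \<pi> \<cdot> enc \<pi>')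
        (bool_tree (rank \<pi> \<le> rank \<pi>')) B"
      using \<pi> \<pi>' by (intro computes_rank_le) (simp_all add: eligible_plans_def)
    from computes_withinD[OF this] show ?thesis
      unfolding unfold_call plan_key_def plan_tree_eq le_cost_def
      using compare support enc eq \<pi>(2) \<pi>'(2) by simp
  qed
qed

lemma computes_Filter_Valid:
  assumes "\<And>g. g \<in> set gs \<Longrightarrow> is_plan (set ss) (set us) (X, g)"
  shows "computes Filter_Valid
     (I \<cdot> set_tree us X \<cdot> list_tree (map (row us ss) gs) \<cdot> list_tree (map pt \<pi>s))
     (list_tree (map pt (filter valid_plan (map (\<lambda>g. (X, g)) gs) @ \<pi>s)))
     (filter_cost B k m * (length gs + 1))"
  using assms
proof (induction gs)
  case Nil
  show ?case unfolding unfold_call filter_cost_def by simp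
next
  case (Cons g gs)
  have IH: "computes Filter_Valid
     (I \<cdot> set_tree us X \<cdot> list_tree (map (row us ss) gs) \<cdot> list_tree (map pt \<pi>s))
     (list_tree (map pt (filter valid_plan (map (\<lambda>g. (X, g)) gs) @ \<pi>s)))
     (filter_cost B k m * (length gs + 1))"
    using Cons by simp
  have "is_plan (set ss) (set us) (X, g)"
    using Cons.prems by simp
  note check = computes_Check[OF this]
  have "pt (X, g) = set_tree us X \<cdot> row us ss g"
    by (simp add: plan_tree_eq)
  then show ?case
    unfolding unfold_call
    using computes_withinD[OF IH] computes_withinD[OF check] filter_cost_def[of B k m]
    by (cases "valid_plan (X, g)") simp_all
qed

lemma computes_Candidates:
  assumes "u \<in> set us" "\<And>\<pi>. \<pi> \<in> set \<pi>s \<Longrightarrow> is_plan (set ss) (set us) \<pi> \<and> users \<pi> = X"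
  shows "computes Candidates
     (I \<cdot> set_tree us (insert u X) \<cdot> entry us (Some u) \<cdot> list_tree (map pt \<pi>s))
     (list_tree (map pt (candidates (insert u X) u \<pi>s)))
     (candidates_cost B k m * (count_extensions \<pi>s + 1))"
  using assms(2)
proof (induction \<pi>s)
  case Nil
  show ?case unfolding unfold_call by (simp add: candidates_def candidates_cost_def)
next
  case (Cons \<pi> \<pi>s)
  let ?gs = "extensions u ss (snd \<pi>)"
  have IH: "computes Candidates
     (I \<cdot> set_tree us (insert u X) \<cdot> entry us (Some u) \<cdot> list_tree (map pt \<pi>s))
     (list_tree (map pt (candidates (insert u X) u \<pi>s)))
     (candidates_cost B k m * (count_extensions \<pi>s + 1))"
    using Cons by simp
  have "is_plan (set ss) (set us) (X, snd \<pi>)"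
    using Cons.prems[of \<pi>] by (metis list.set_intros(1) prod.collapse)
  then have "is_plan (set ss) (set us) (insert u X, g)" if "g \<in> set ?gs" for g
    using that assms(1) by (intro is_plan_extension[where f = "snd \<pi>"]) auto
  note filter = computes_Filter_Valid[where gs = ?gs and
      \<pi>s = "candidates (insert u X) u \<pi>s", OF this]
  note extend = computes_Extend[OF distinct_ss, of us u "snd \<pi>"]
  have cand: "candidates (insert u X) u (\<pi> # \<pi>s) =
      filter valid_plan (map (\<lambda>g. (insert u X, g)) ?gs) @ candidates (insert u X) u \<pi>s"
    by (simp add: candidates_def)
  have count: "count_extensions (\<pi> # \<pi>s) = length ?gs + count_extensions \<pi>s"
    by (simp add: count_extensions_def length_extensions distinct_ss)
  obtain z where "length ?gs = Suc z"
    using gr0_implies_Suc[OF length_extensions_pos[of u ss "snd \<pi>"]] by blast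
  then have "300 * (k + 1) * length ?gs + filter_cost B k m * (length ?gs + 1) +
      candidates_cost B k m * (count_extensions \<pi>s + 1) + 100 \<le>
      candidates_cost B k m * (count_extensions (\<pi> # \<pi>s) + 1)"
    unfolding candidates_cost_def count by (simp add: algebra_simps)
  then show ?case
    unfolding unfold_call cand
    using computes_withinD[OF IH] computes_withinD[OF extend] computes_withinD[OF filter]
    by (simp add: plan_tree_eq[of ss us \<pi>])
qed

lemma computes_Prefix_U:
  "computes Prefix (num_tree n \<cdot> num_tree i) (set_tree us (U i)) (30 * (n + 1))"
  unfolding set_tree_take[OF distinct_us] by (rule computes_Prefix)

lemma computes_Candidates_level:
  assumes i: "i < n"
  shows "computes Candidates
     (I \<cdot> set_tree us (U (Suc i)) \<cdot> num_tree (Suc i) \<cdot> list_tree (map pt (level i)))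
     (list_tree (map pt (candidates (U (Suc i)) (us ! i) (level i))))
     (candidates_cost B k m * (table_size + 1))"
proof -
  have "set (level i) \<subseteq> valid_plans (U i)"
    using transversal_level[of i] i by (simp add: transversal_def)
  then have "is_plan (set ss) (set us) \<pi> \<and> users \<pi> = U i" if "\<pi> \<in> set (level i)" for \<pi>
    using that by (auto simp: valid_plans_def valid_def eligible_def)
  note computes_Candidates[OF nth_mem[OF i] this, folded U_Suc[OF i] entry_nth[OF distinct_us i]]
  moreover have "candidates_cost B k m * (count_extensions (level i) + 1) \<le>
      candidates_cost B k m * (table_size + 1)"
    using count_extensions_level_le[of i] i by (intro mult_le_mono2) simp
  ultimately show ?thesis
    unfolding entry_nth[OF distinct_us i] by (rule computes_within_mono)
qed

lemma computes_Sort_level: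
  assumes i: "i < n" and d: "table_size \<le> 2 ^ d"
  shows "computes Sort (D \<cdot> list_tree (map pt (candidates (U (Suc i)) (us ! i) (level i))))
     (list_tree (map pt (level (Suc i)))) (sort_cost (le_cost B k) * (d + 1) * table_size + 20)"
  unfolding level.simps
proof (rule computes_within_mono[OF computes_Sort])
  let ?candidates = "candidates (U (Suc i)) (us ! i) (level i)"
  have size: "length ?candidates \<le> table_size"
    using order_trans[OF length_candidates_le count_extensions_level_le[of i]] i by simp
  show "set ?candidates \<subseteq> valid_plans (U (Suc i))"
    by (rule set_candidates)
  show "length ?candidates \<le> 2 ^ d"
    using size d by (rule order_trans)
  show "sort_cost (le_cost B k) * (d + 1) * length ?candidates + 20 \<le>
      sort_cost (le_cost B k) * (d + 1) * table_size + 20"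
    using size by (intro add_mono mult_le_mono2) simp_all
qed (rule computes_Le; simp add: valid_plans_def valid_def)

lemma computes_Loop:
  assumes "i + r = n" and d: "table_size \<le> 2 ^ d"
  shows "computes Loop (I \<cdot> num_tree r \<cdot> num_tree i \<cdot> list_tree (map pt (level i)))
     (list_tree (map pt (level n))) (r * (level_cost B n k m * ((d + 1) * table_size)) + 20)"
  using assms(1)
proof (induction r arbitrary: i)
  case 0
  then show ?case unfolding unfold_call by simp
next
  case (Suc r)
  let ?F = "(d + 1) * table_size"
  have i: "i < n" and IH: "computes Loop
     (I \<cdot> num_tree r \<cdot> num_tree (Suc i) \<cdot> list_tree (map pt (level (Suc i))))
     (list_tree (map pt (level n))) (r * (level_cost B n k m * ?F) + 20)"
    using Suc.prems Suc.IH[of "Suc i"] by simp_all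
  have "1 \<le> table_size"
    by simp
  from level_time_le[OF this, of n B k m d] show ?case
    unfolding unfold_call
    using computes_withinD[OF IH] computes_withinD[OF computes_Prefix_U[of "Suc i"]]
      computes_withinD[OF computes_Candidates_level[OF i]]
      computes_withinD[OF computes_Sort_level[OF i d]]
    by (simp add: instance_tree_def del: level.simps)
qed

lemma computes_level_0:
  "computes Filter_Valid (I \<cdot> set_tree us (U 0) \<cdot> (num_tree k \<cdot> Leaf) \<cdot> Leaf)
     (list_tree (map pt (level 0))) (2 * filter_cost B k m)"
proof -
  have "is_plan (set ss) (set us) ({}, g)" if "g \<in> set [Map.empty]" for g
    using that by (simp add: is_plan_def)
  note computes_Filter_Valid[where gs = "[Map.empty]" and \<pi>s = "[]", OF this]
  then show ?thesis
    by (cases "valid_plan ({}, Map.empty)") (simp_all add: row_empty mult_2)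
qed

lemma computes_Main:
  assumes d: "table_size \<le> 2 ^ d"
  shows "\<exists>v. wsp_answer ss us A (set cs) v \<and>
    computes Main I v (solve_cost B n k m * ((d + 1) * table_size))"
proof -
  let ?F = "(d + 1) * table_size"
  let ?find = "find (\<lambda>\<pi>. set ss \<subseteq> tasks \<pi>) (level n)"
  let ?v = "case ?find of None \<Rightarrow> Leaf | Some \<pi> \<Rightarrow> Leaf \<cdot> pt \<pi>"
  have level: "transversal R (valid_plans (set us)) (set (level n))"
    using transversal_level[of n] by simp
  have loop: "computes Loop (I \<cdot> num_tree n \<cdot> Leaf \<cdot> list_tree (map pt (level 0)))
      (list_tree (map pt (level n))) (n * (level_cost B n k m * ?F) + 20)"
    using computes_Loop[OF _ d, of 0 n] by simp
  have "length (level n) \<le> table_size"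
    using length_le_count_extensions count_extensions_level_le[of n] by (rule order_trans) simp
  then have "60 * (k + 1) * (length (level n) + 1) \<le> 60 * (k + 1) * (table_size + 1)"
    by (intro mult_le_mono2) simp
  note find = computes_within_mono[OF computes_Find[of ss us "level n"] this]
  have "1 \<le> table_size" "table_size \<le> ?F"
    by simp_all
  from solve_time_le[OF this, of n B k m] have "computes Main I ?v (solve_cost B n k m * ?F)"
    unfolding unfold_call
    using computes_withinD[OF loop] computes_withinD[OF computes_Prefix_U[of 0]]
      computes_withinD[OF computes_level_0] computes_withinD[OF find]
    by (simp add: instance_tree_def del: level.simps)
  with wsp_answer_find[OF level] show ?thesis by blast
qed

lemma Main_solves_wsp:
  defines "w \<equiv> max 2 (width (set ss) us (set cs) R)"
  shows "\<exists>v t. runs P (ix Main) I v t \<and> wsp_answer ss us A (set cs) v \<and>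
    real t \<le> real ((2 * k + 3) * solve_cost B n k m) * (3 ^ k * real w * log 2 (real w))"
proof -
  define d where "d = ceillog2 w + 2 * k"
  have "w * 3 ^ k \<le> 2 ^ ceillog2 w * 4 ^ k"
    using le_two_power_ceillog2 by (intro mult_mono power_mono) simp_all
  also have "\<dots> = 2 ^ d"
    by (simp add: d_def power_add power_mult)
  finally obtain v t where v: "wsp_answer ss us A (set cs) v" and run: "runs P (ix Main) I v t"
    and t: "t \<le> solve_cost B n k m * ((d + 1) * (w * 3 ^ k))"
    using computes_Main[of d] unfolding computes_within_def w_def by blast
  have "1 \<le> log 2 (real w)"
    by (simp add: w_def le_log_iff)
  then have "2 * real k + 2 \<le> (2 * real k + 2) * log 2 (real w)"
    by (intro mult_le_cancel_left1[THEN iffD2]) simp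
  moreover have "real (ceillog2 w) < log 2 (real w) + 1"
    by (rule ceillog2_less_log) (simp add: w_def)
  ultimately have depth: "real (d + 1) \<le> (2 * real k + 3) * log 2 (real w)"
    by (simp add: d_def algebra_simps)
  have "real t \<le> real (solve_cost B n k m * ((d + 1) * (w * 3 ^ k)))"
    using t by (rule of_nat_mono)
  also have "\<dots> = real (solve_cost B n k m) * (real w * 3 ^ k) * real (d + 1)"
    by (simp add: algebra_simps)
  also have "\<dots> \<le>
      real (solve_cost B n k m) * (real w * 3 ^ k) * ((2 * real k + 3) * log 2 (real w))"
    using depth by (rule mult_left_mono) simp
  also have "\<dots> = real ((2 * k + 3) * solve_cost B n k m) * (3 ^ k * real w * log 2 (real w))"
    by simp
  finally have "real t \<le> \<dots>" .
  with v run show ?thesis by blast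
qed

end

lemma ex_wsp_solver:
  assumes "solver ix fa fc fe fo P" "distinct ss" "distinct us"
    and "plan_indistinguishability (set ss) (set us) (set cs) R"
    and "checkable_within P fa fc B D ss us cs A"
    and "encoding_within P fe fo B D ss us (set cs) R enc"
  shows "\<exists>rank. wsp_solver ix fa fc fe fo P ss us cs A R D enc rank B"
proof -
  obtain rank where "wsp_solver_axioms fa fc fe fo P ss us cs A R D enc rank B"
    using encoding_within_ex_plan_rank[OF assms(6)] encoding_within_computes_enc[OF assms(6)]
      assms(5)
    unfolding wsp_solver_axioms_def by blast
  moreover have "wsp ss us cs R"
    using assms(2-4) by (rule wsp.intro)
  ultimately show ?thesis
    using assms(1) wsp_solver.intro by blast
qed

lemma checkable_within_append:
  "checkable_within P fa fc B D ss us cs A \<Longrightarrow> checkable_within (P @ Q) fa fc B D ss us cs A"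
  unfolding checkable_within_def by (blast intro: computes_within_append)

lemma encoding_within_append:
  "encoding_within P fe fo B D ss us C R enc \<Longrightarrow> encoding_within (P @ Q) fe fo B D ss us C R enc"
  unfolding encoding_within_def Let_def by (meson computes_within_append)

lemma polynomial3_solve_cost:
  "polynomial3 p \<Longrightarrow> polynomial3 (\<lambda>n k m. (2 * k + 3) * solve_cost (p n k m) n k m)"
  unfolding solve_cost_def level_cost_def candidates_cost_def filter_cost_def check_cost_def
    sort_cost_def le_cost_def
  by (intro polynomial3.intros)

theorem theorem14:
  fixes Lib :: program and fa fc fe fo :: nat and p :: "nat \<Rightarrow> nat \<Rightarrow> nat \<Rightarrow> nat"
  assumes "polynomial3 p"
  shows "\<exists>(Solver :: program) (main :: nat) q. polynomial3 q \<and>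
    (\<forall>(S :: 's set) (U :: 'u set) A C ss us cs D R w n k m.
       wsp_instance S U A C \<and> n = card U \<and> k = card S \<and> m = card C \<and>
       enumerates ss S \<and> enumerates us U \<and> enumerates cs C \<and>
       checkable_within Lib fa fc (p n k m) D ss us cs A \<and>
       plan_indistinguishability S U C R \<and> width S us C R = w \<and>
       (\<exists>enc. encoding_within Lib fe fo (p n k m) D ss us C R enc) \<longrightarrow>
       (\<exists>v t. runs Solver main (instance_tree D ss us cs) v t \<and> wsp_answer ss us A C v \<and>
          real t \<le> real (q n k m) *
            (3 ^ k * real (max 2 w) * log 2 (real (max 2 w)))))"
proof -
  obtain Q ix where solver: "solver ix fa fc fe fo (Lib @ Q)"
    using ex_solver by blast
  let ?q = "\<lambda>n k m. (2 * k + 3) * solve_cost (p n k m) n k m"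
  show ?thesis
  proof (rule exI[of _ "Lib @ Q"], rule exI[of _ "ix Main"], rule exI[of _ ?q],
      intro conjI allI impI, goal_cases polynomial solved)
    case polynomial
    show ?case
      by (rule polynomial3_solve_cost[OF assms])
  next
    case (solved S U A C ss us cs D R w n k m)
    then have lists: "S = set ss" "U = set us" "C = set cs" "n = length us" "k = length ss"
      "m = length cs" and distinct: "distinct ss" "distinct us"
      by (auto simp: enumerates_def distinct_card)
    from solved obtain enc where "encoding_within (Lib @ Q) fe fo (p n k m) D ss us (set cs) R enc"
      unfolding lists using encoding_within_append by blast
    with solved obtain rank
      where "wsp_solver ix fa fc fe fo (Lib @ Q) ss us cs A R D enc rank (p n k m)"
      using ex_wsp_solver[OF solver distinct] checkable_within_append unfolding lists by blast
    from wsp_solver.Main_solves_wsp[OF this] solved show ?case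
      unfolding lists by simp
  qed
qed

end
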